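(* Let $\mathbb{F}$ be a field with $|\mathbb{F}|>2$ and let $n\ge 3$. Suppose that $\boldsymbol{\lambda}\in\mathcal{C}$ but $\boldsymbol{\lambda}\notin\mathcal{M}^{\ast\ast}$. Then $\boldsymbol{\lambda}$ linearly degenerates to $\boldsymbol{\delta}$, so $\mathcal{N}\subseteq\boldsymbol{\lambda}(\mathbb{F}G)$. Moreover, $\mathcal{N}/(\mathcal{N}\cap\mathcal{M}^{\ast\ast})$ is an irreducible $G$-module.
   Context: $V$ is an $n$-dimensional vector space over $\mathbb{F}$ with a fixed basis $v_1,\dots,v_n$; $G=GL(V)$ acts on $V$ on the left. $\boldsymbol{\Lambda}=\mathbb{F}^{n^3}$ is the space of structure vectors $\boldsymbol{\lambda}=(\lambda_{ijk})_{1\le i,j,k\le n}$; such a vector corresponds to the (not necessarily associative) algebra on $V$ whose bilinear product is $[v_i,v_j]=\sum_k\lambda_{ijk}v_k$. $G$ acts linearly on $\boldsymbol{\Lambda}$ on the right: $\boldsymbol{\lambda}g$ is the structure vector of the product $[u,v]'=g^{-1}[gu,gv]$. This makes $\boldsymbol{\Lambda}$ a right module over the group algebra $\mathbb{F}G$; $\boldsymbol{\lambda}$ linearly degenerates to $\boldsymbol{\lambda}'$ if $\boldsymbol{\lambda}'\in\boldsymbol{\lambda}(\mathbb{F}G)$, the $G$-submodule generated by $\boldsymbol{\lambda}$. $\boldsymbol{\delta}=\mathbf{112}$ is the element of $\boldsymbol{\Lambda}$ whose $(1,1,2)$-component is $1$ and whose other components are all $0$. Define the following $G$-submodules of $\boldsymbol{\Lambda}$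 (where $[\,,\,]$ is the product with structure vector $\boldsymbol{\lambda}$): $\mathcal{C}$ = all $\boldsymbol{\lambda}$ with $[u,v]=[v,u]$ for all $u,v\in V$; $\mathcal{T}$ = all $\boldsymbol{\lambda}$ such that for every $u\in V$ the linear map $v\mapsto[u,v]$ has trace $0$; $\mathcal{N}=\mathcal{C}\cap\mathcal{T}$; $\mathcal{M}^{\ast\ast}$ = all $\boldsymbol{\lambda}$ with $[v,v]\in\mathbb{F}v$ for all $v\in V$. *)

theory Defs
  imports "HOL-Algebra.Algebra" "HOL-Algebra.Algebraic_Closure_Type"
begin

locale right_gmodule = G: group G + M: module R M
  for G :: "('g, 'x) monoid_scheme" and R :: "('r, 'y) ring_scheme"
    and M :: "('r, 'm) module" +
  fixes act :: "'m \<Rightarrow> 'g \<Rightarrow> 'm"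
  assumes act_closed: "\<lbrakk>m \<in> carrier M; g \<in> carrier G\<rbrakk> \<Longrightarrow> act m g \<in> carrier M"
    and act_one: "m \<in> carrier M \<Longrightarrow> act m \<one>\<^bsub>G\<^esub> = m"
    and act_mult: "\<lbrakk>m \<in> carrier M; g \<in> carrier G; h \<in> carrier G\<rbrakk>
      \<Longrightarrow> act m (g \<otimes>\<^bsub>G\<^esub> h) = act (act m g) h"
    and act_add: "\<lbrakk>m \<in> carrier M; m' \<in> carrier M; g \<in> carrier G\<rbrakk>
      \<Longrightarrow> act (m \<oplus>\<^bsub>M\<^esub> m') g = act m g \<oplus>\<^bsub>M\<^esub> act m' g"
    and act_smult: "\<lbrakk>a \<in> carrier R; m \<in> carrier M; g \<in> carrier G\<rbrakk>
      \<Longrightarrow> act (a \<odot>\<^bsub>M\<^esub> m) g = a \<odot>\<^bsub>M\<^esub> act m g"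

definition gsubmodule ::
  "('g, 'x) monoid_scheme \<Rightarrow> ('r, 'y) ring_scheme \<Rightarrow> ('r, 'm) module \<Rightarrow> ('m \<Rightarrow> 'g \<Rightarrow> 'm)
    \<Rightarrow> 'm set \<Rightarrow> bool"
  where "gsubmodule G R M act W \<longleftrightarrow>
    submodule W R M \<and> (\<forall>w\<in>W. \<forall>g\<in>carrier G. act w g \<in> W)"

locale irreducible_gmodule = right_gmodule +
  assumes nontrivial: "carrier M \<noteq> {\<zero>\<^bsub>M\<^esub>}"
    and irreducible: "gsubmodule G R M act W \<Longrightarrow> W = {\<zero>\<^bsub>M\<^esub>} \<or> W = carrier M"

(* HOL-Algebra modules extend the ring record; the fields mult and one play no role in
   the theory of modules and are left unspecified below. *)
definition quot_module :: "('r, 'm) module \<Rightarrow> 'm set \<Rightarrow> ('r, 'm set) module"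
  where "quot_module M H =
    \<lparr>carrier = a_rcosets\<^bsub>M\<^esub> H, monoid.mult = undefined, monoid.one = undefined,
     ring.zero = H, ring.add = set_add M,
     module.smult = (\<lambda>a A. \<Union>x\<in>A. H +>\<^bsub>M\<^esub> (a \<odot>\<^bsub>M\<^esub> x))\<rparr>"

definition quot_act ::
  "('r, 'm) module \<Rightarrow> 'm set \<Rightarrow> ('m \<Rightarrow> 'g \<Rightarrow> 'm) \<Rightarrow> 'm set \<Rightarrow> 'g \<Rightarrow> 'm set"
  where "quot_act M H act A g = (\<Union>x\<in>A. H +>\<^bsub>M\<^esub> act x g)"

(* Elements of the group algebra are the finitely supported functions G -> R. *)
definition group_algebra ::
  "('g, 'x) monoid_scheme \<Rightarrow> ('r, 'y) ring_scheme \<Rightarrow> ('g \<Rightarrow> 'r) set"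
  where "group_algebra G R =
    {c. range c \<subseteq> carrier R \<and> {g. c g \<noteq> \<zero>\<^bsub>R\<^esub>} \<subseteq> carrier G \<and> finite {g. c g \<noteq> \<zero>\<^bsub>R\<^esub>}}"

definition group_algebra_act ::
  "('r, 'y) ring_scheme \<Rightarrow> ('r, 'm) module \<Rightarrow> ('m \<Rightarrow> 'g \<Rightarrow> 'm) \<Rightarrow> 'm \<Rightarrow> ('g \<Rightarrow> 'r) \<Rightarrow> 'm"
  where "group_algebra_act R M act m c =
    (\<Oplus>\<^bsub>M\<^esub>g\<in>{g. c g \<noteq> \<zero>\<^bsub>R\<^esub>}. c g \<odot>\<^bsub>M\<^esub> act m g)"

definition cyclic_gsubmodule ::
  "('g, 'x) monoid_scheme \<Rightarrow> ('r, 'y) ring_scheme \<Rightarrow> ('r, 'm) module \<Rightarrow> ('m \<Rightarrow> 'g \<Rightarrow> 'm)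
    \<Rightarrow> 'm \<Rightarrow> 'm set"
  where "cyclic_gsubmodule G R M act m = group_algebra_act R M act m ` group_algebra G R"

abbreviation base_field :: "'f::field ring"
  where "base_field \<equiv> ring_of_type_algebra"

(* F^(n^3): only the components with all three indices in {1..n} are meaningful; the
   others are required to be 0, so that equality of structure vectors is equality of
   functions. *)
definition Lambda :: "nat \<Rightarrow> ('f::field, nat \<Rightarrow> nat \<Rightarrow> nat \<Rightarrow> 'f) module"
  where "Lambda n =
    \<lparr>carrier = {l. \<forall>i j k. l i j k \<noteq> 0 \<longrightarrow> i \<in> {1..n} \<and> j \<in> {1..n} \<and> k \<in> {1..n}},
     monoid.mult = undefined, monoid.one = undefined,
     ring.zero = (\<lambda>i j k. 0), ring.add = (\<lambda>l l' i j k. l i j k + l' i j k),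
     module.smult = (\<lambda>a l i j k. a * l i j k)\<rparr>"

definition delta :: "nat \<Rightarrow> nat \<Rightarrow> nat \<Rightarrow> 'f::field"
  where "delta i j k = (if i = 1 \<and> j = 1 \<and> k = 2 then 1 else 0)"

locale based_vector_space = vector_space scale
  for scale :: "'f::field \<Rightarrow> 'v::ab_group_add \<Rightarrow> 'v" (infixr \<open>*s\<close> 75) +
  fixes n :: nat and v :: "nat \<Rightarrow> 'v"
  assumes basis_inj: "inj_on v {1..n}"
    and basis_independent: "independent (v ` {1..n})"
    and basis_span: "span (v ` {1..n}) = UNIV"
begin

definition coord :: "'v \<Rightarrow> nat \<Rightarrow> 'f"
  where "coord x i = representation (v ` {1..n}) x (v i)"

definition bracket :: "(nat \<Rightarrow> nat \<Rightarrow> nat \<Rightarrow> 'f) \<Rightarrow> 'v \<Rightarrow> 'v \<Rightarrow> 'v"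
  where "bracket l x y =
    (\<Sum>i\<in>{1..n}. \<Sum>j\<in>{1..n}. (coord x i * coord y j) *s (\<Sum>k\<in>{1..n}. l i j k *s v k))"

definition structure_vector :: "('v \<Rightarrow> 'v \<Rightarrow> 'v) \<Rightarrow> nat \<Rightarrow> nat \<Rightarrow> nat \<Rightarrow> 'f"
  where "structure_vector p i j k =
    (if i \<in> {1..n} \<and> j \<in> {1..n} \<and> k \<in> {1..n} then coord (p (v i) (v j)) k else 0)"

(* With composition as the product, act below is a right action of GL. *)
definition GL :: "('v \<Rightarrow> 'v) monoid"
  where "GL = \<lparr>carrier = {g. Vector_Spaces.linear scale scale g \<and> bij g},
    monoid.mult = (\<circ>), monoid.one = id\<rparr>"

(* The structure vector of the product g^-1 [g u, g v]. *)
definition act ::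
  "(nat \<Rightarrow> nat \<Rightarrow> nat \<Rightarrow> 'f) \<Rightarrow> ('v \<Rightarrow> 'v) \<Rightarrow> nat \<Rightarrow> nat \<Rightarrow> nat \<Rightarrow> 'f"
  where "act l g = structure_vector (\<lambda>x y. inv_into UNIV g (bracket l (g x) (g y)))"

definition trace :: "('v \<Rightarrow> 'v) \<Rightarrow> 'f"
  where "trace f = (\<Sum>i\<in>{1..n}. coord (f (v i)) i)"

definition FG_submodule :: "(nat \<Rightarrow> nat \<Rightarrow> nat \<Rightarrow> 'f) \<Rightarrow> (nat \<Rightarrow> nat \<Rightarrow> nat \<Rightarrow> 'f) set"
  where "FG_submodule l = cyclic_gsubmodule GL base_field (Lambda n) act l"

definition linearly_degenerates ::
  "(nat \<Rightarrow> nat \<Rightarrow> nat \<Rightarrow> 'f) \<Rightarrow> (nat \<Rightarrow> nat \<Rightarrow> nat \<Rightarrow> 'f) \<Rightarrow> bool"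
  where "linearly_degenerates l l' \<longleftrightarrow> l' \<in> FG_submodule l"

definition C_mod :: "(nat \<Rightarrow> nat \<Rightarrow> nat \<Rightarrow> 'f) set"
  where "C_mod = {l \<in> carrier (Lambda n). \<forall>x y. bracket l x y = bracket l y x}"

definition T_mod :: "(nat \<Rightarrow> nat \<Rightarrow> nat \<Rightarrow> 'f) set"
  where "T_mod = {l \<in> carrier (Lambda n). \<forall>x. trace (bracket l x) = 0}"

definition N_mod :: "(nat \<Rightarrow> nat \<Rightarrow> nat \<Rightarrow> 'f) set"
  where "N_mod = C_mod \<inter> T_mod"

definition Mss_mod :: "(nat \<Rightarrow> nat \<Rightarrow> nat \<Rightarrow> 'f) set"
  where "Mss_mod = {l \<in> carrier (Lambda n). \<forall>x. \<exists>a. bracket l x x = a *s x}"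

definition N_quot :: "('f, (nat \<Rightarrow> nat \<Rightarrow> nat \<Rightarrow> 'f) set) module"
  where "N_quot = quot_module ((Lambda n)\<lparr>carrier := N_mod\<rparr>) (N_mod \<inter> Mss_mod)"

definition N_quot_act ::
  "(nat \<Rightarrow> nat \<Rightarrow> nat \<Rightarrow> 'f) set \<Rightarrow> ('v \<Rightarrow> 'v) \<Rightarrow> (nat \<Rightarrow> nat \<Rightarrow> nat \<Rightarrow> 'f) set"
  where "N_quot_act = quot_act ((Lambda n)\<lparr>carrier := N_mod\<rparr>) (N_mod \<inter> Mss_mod) act"

end

end

theory Submission
  imports Defs
begin

text \<open>
  Let \<open>W\<close> be a \<open>G\<close>-submodule containing some \<open>\<lambda>\<close> with \<open>z = [w, w] \<notin> F w\<close>. For a functional \<open>\<phi>\<close> with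
  \<open>\<phi>(w) = 0\<close>, acting on \<open>\<lambda>\<close> by the transvection \<open>1 + \<phi> \<otimes> w\<close> gives a polynomial in \<open>\<phi>\<close> whose cubic part is
  \<open>- \<phi>(x) \<phi>(y) \<phi>(z) w\<close>. Taking \<open>\<phi> = a \<alpha> + b \<beta>\<close> with \<open>\<alpha>(z) = 0\<close>, \<open>\<beta>(z) = 1\<close> (possible since \<open>n \<ge> 3\<close>), the
  coefficient of \<open>a\<^sup>2 b\<close> is \<open>- \<alpha>\<^sup>2 \<otimes> w\<close>, and finite differences extract it as soon as \<open>F\<close> has an element
  other than \<open>0, 1\<close>. Thus \<open>W\<close> contains a conjugate of \<open>\<delta>\<close>, hence all \<open>\<phi>\<^sup>2 \<otimes> w\<close> with \<open>\<phi>(w) = 0\<close>, and these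
  span \<open>N\<close>. So every \<open>G\<close>-submodule of \<open>N\<close> that is not contained in \<open>M\<^sup>*\<^sup>*\<close> is all of \<open>N\<close>, which
  gives irreducibility of the quotient.
\<close>

section \<open>Submodules and quotients of right group modules\<close>

context right_gmodule begin

lemma gsubmoduleI:
  assumes "W \<subseteq> carrier M" "\<zero>\<^bsub>M\<^esub> \<in> W"
    and "\<And>x y. \<lbrakk>x \<in> W; y \<in> W\<rbrakk> \<Longrightarrow> x \<oplus>\<^bsub>M\<^esub> y \<in> W"
    and smult: "\<And>a x. \<lbrakk>a \<in> carrier R; x \<in> W\<rbrakk> \<Longrightarrow> a \<odot>\<^bsub>M\<^esub> x \<in> W"
    and "\<And>x g. \<lbrakk>x \<in> W; g \<in> carrier G\<rbrakk> \<Longrightarrow> act x g \<in> W"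
  shows "gsubmodule G R M act W"
proof -
  \<comment> \<open>Negation is multiplication by -1, so closure under scalars already gives closure
    under negatives.\<close>
  have "\<ominus>\<^bsub>M\<^esub> x \<in> W" if "x \<in> W" for x
    using smult[of "\<ominus>\<^bsub>R\<^esub> \<one>\<^bsub>R\<^esub>" x] that assms(1) by (auto simp: M.smult_l_minus)
  then show ?thesis
    unfolding gsubmodule_def using assms by (auto intro!: M.submoduleI)
qed

lemma gsubmoduleD:
  assumes "gsubmodule G R M act W"
  shows "W \<subseteq> carrier M" "\<zero>\<^bsub>M\<^esub> \<in> W"
    and "\<lbrakk>x \<in> W; y \<in> W\<rbrakk> \<Longrightarrow> x \<oplus>\<^bsub>M\<^esub> y \<in> W"
    and "\<lbrakk>a \<in> carrier R; x \<in> W\<rbrakk> \<Longrightarrow> a \<odot>\<^bsub>M\<^esub> x \<in> W"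
    and "\<lbrakk>x \<in> W; g \<in> carrier G\<rbrakk> \<Longrightarrow> act x g \<in> W"
    and "submodule W R M"
proof -
  show *: "submodule W R M" using assms by (simp add: gsubmodule_def)
  then show "\<zero>\<^bsub>M\<^esub> \<in> W" using subgroup.one_closed[OF submodule.axioms(1)[OF *]] by simp
qed (use assms M.submoduleE in \<open>auto simp: gsubmodule_def\<close>)

lemma act_zero: "g \<in> carrier G \<Longrightarrow> act \<zero>\<^bsub>M\<^esub> g = \<zero>\<^bsub>M\<^esub>"
  using act_smult[of "\<zero>\<^bsub>R\<^esub>" "\<zero>\<^bsub>M\<^esub>" g] by (simp add: act_closed)

text \<open>Elements of the group algebra have different supports; summing over any finite superset
  of the support allows two of them to be added term by term.\<close>

lemma group_algebra_act_eq_finsum: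
  assumes "m \<in> carrier M" "c \<in> group_algebra G R" "finite S" "{g. c g \<noteq> \<zero>\<^bsub>R\<^esub>} \<subseteq> S" "S \<subseteq> carrier G"
  shows "group_algebra_act R M act m c = (\<Oplus>\<^bsub>M\<^esub>g\<in>S. c g \<odot>\<^bsub>M\<^esub> act m g)"
  unfolding group_algebra_act_def
  by (rule M.add.finprod_mono_neutral_cong_left)
     (use assms in \<open>auto simp: group_algebra_def act_closed image_subset_iff\<close>)

section \<open>The submodule generated by one element\<close>

lemma cyclic_add:
  assumes m: "m \<in> carrier M"
    and "x \<in> cyclic_gsubmodule G R M act m" "y \<in> cyclic_gsubmodule G R M act m"
  shows "x \<oplus>\<^bsub>M\<^esub> y \<in> cyclic_gsubmodule G R M act m"
proof -
  obtain c d where c: "c \<in> group_algebra G R" "x = group_algebra_act R M act m c"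
    and d: "d \<in> group_algebra G R" "y = group_algebra_act R M act m d"
    using assms by (auto simp: cyclic_gsubmodule_def)
  define S where "S = {g. c g \<noteq> \<zero>\<^bsub>R\<^esub>} \<union> {g. d g \<noteq> \<zero>\<^bsub>R\<^esub>}"
  have S: "finite S" "S \<subseteq> carrier G"
    using c(1) d(1) by (auto simp: S_def group_algebra_def)
  have rng: "c g \<in> carrier R" "d g \<in> carrier R" for g
    using c(1) d(1) by (auto simp: group_algebra_def)
  define e where "e g = c g \<oplus>\<^bsub>R\<^esub> d g" for g
  \<comment> \<open>Coefficients may cancel, so the support of \<open>e\<close> can be strictly
    smaller than \<open>S\<close>.\<close>
  have sub: "{g. e g \<noteq> \<zero>\<^bsub>R\<^esub>} \<subseteq> S" by (auto simp: e_def S_def)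
  have e: "e \<in> group_algebra G R"
    using sub S rng finite_subset by (auto simp: group_algebra_def e_def)
  have "group_algebra_act R M act m e = (\<Oplus>\<^bsub>M\<^esub>g\<in>S. e g \<odot>\<^bsub>M\<^esub> act m g)"
    by (rule group_algebra_act_eq_finsum[OF m e S(1) sub S(2)])
  also have "\<dots> = (\<Oplus>\<^bsub>M\<^esub>g\<in>S. c g \<odot>\<^bsub>M\<^esub> act m g \<oplus>\<^bsub>M\<^esub> d g \<odot>\<^bsub>M\<^esub> act m g)"
    using S rng m by (intro M.add.finprod_cong') (auto simp: e_def M.smult_l_distr act_closed)
  also have "\<dots> = (\<Oplus>\<^bsub>M\<^esub>g\<in>S. c g \<odot>\<^bsub>M\<^esub> act m g) \<oplus>\<^bsub>M\<^esub> (\<Oplus>\<^bsub>M\<^esub>g\<in>S. d g \<odot>\<^bsub>M\<^esub> act m g)"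
    using S rng m by (intro M.finsum_addf) (auto simp: act_closed)
  also have "\<dots> = x \<oplus>\<^bsub>M\<^esub> y"
    using group_algebra_act_eq_finsum[OF m c(1) S(1) _ S(2)]
      group_algebra_act_eq_finsum[OF m d(1) S(1) _ S(2)] by (simp add: c d S_def)
  finally show ?thesis unfolding cyclic_gsubmodule_def using e by (metis image_eqI)
qed

lemma cyclic_single:
  assumes m: "m \<in> carrier M" and "a \<in> carrier R" "g \<in> carrier G"
  shows "a \<odot>\<^bsub>M\<^esub> act m g \<in> cyclic_gsubmodule G R M act m"
proof -
  define c where "c h = (if h = g then a else \<zero>\<^bsub>R\<^esub>)" for h
  have sub: "{h. c h \<noteq> \<zero>\<^bsub>R\<^esub>} \<subseteq> {g}" by (auto simp: c_def)
  have c: "c \<in> group_algebra G R"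
    using assms finite_subset[OF sub] by (auto simp: group_algebra_def c_def split: if_splits)
  have "group_algebra_act R M act m c = (\<Oplus>\<^bsub>M\<^esub>h\<in>{g}. c h \<odot>\<^bsub>M\<^esub> act m h)"
    using assms by (intro group_algebra_act_eq_finsum[OF m c _ sub]) auto
  also have "\<dots> = a \<odot>\<^bsub>M\<^esub> act m g"
    using assms by (simp add: c_def act_closed)
  finally show ?thesis unfolding cyclic_gsubmodule_def using c by (metis image_eqI)
qed

text \<open>Builds an element one translate of \<open>m\<close> at a time. Closure under scalars and
  under the group then only needs the effect on a single translate, with no convolution of
  coefficient functions.\<close>

lemma cyclic_induct [consumes 2, case_names zero step]:
  assumes "m \<in> carrier M" "x \<in> cyclic_gsubmodule G R M act m"
    and "P \<zero>\<^bsub>M\<^esub>"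
    and "\<And>a g y. \<lbrakk>a \<in> carrier R; g \<in> carrier G; y \<in> carrier M; P y\<rbrakk>
      \<Longrightarrow> P (a \<odot>\<^bsub>M\<^esub> act m g \<oplus>\<^bsub>M\<^esub> y)"
  shows "P x"
proof -
  obtain c where c: "c \<in> group_algebra G R" and x: "x = group_algebra_act R M act m c"
    using assms by (auto simp: cyclic_gsubmodule_def)
  have rng: "c g \<in> carrier R" for g using c by (auto simp: group_algebra_def)
  \<comment> \<open>The coefficients \<open>c\<close> stay fixed while the index set grows; the
    support of \<open>c\<close> is the instance wanted.\<close>
  have "P (\<Oplus>\<^bsub>M\<^esub>g\<in>S. c g \<odot>\<^bsub>M\<^esub> act m g)" if "finite S" "S \<subseteq> carrier G" for S
    using that
  proof (induction S)
    case (insert g S)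
    then have "(\<Oplus>\<^bsub>M\<^esub>h\<in>insert g S. c h \<odot>\<^bsub>M\<^esub> act m h)
        = c g \<odot>\<^bsub>M\<^esub> act m g \<oplus>\<^bsub>M\<^esub> (\<Oplus>\<^bsub>M\<^esub>h\<in>S. c h \<odot>\<^bsub>M\<^esub> act m h)"
      using rng assms(1) by (intro M.finsum_insert) (auto simp: act_closed)
    moreover have "(\<Oplus>\<^bsub>M\<^esub>h\<in>S. c h \<odot>\<^bsub>M\<^esub> act m h) \<in> carrier M"
      using insert rng assms(1) by (intro M.finsum_closed) (auto simp: act_closed)
    ultimately show ?case using insert rng assms(4) by simp
  qed (simp add: assms(3))
  then show ?thesis
    using c by (auto simp: x group_algebra_act_def group_algebra_def)
qed

lemma cyclic_zero:
  assumes "m \<in> carrier M"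
  shows "\<zero>\<^bsub>M\<^esub> \<in> cyclic_gsubmodule G R M act m"
  using cyclic_single[OF assms M.R.zero_closed G.one_closed] assms
  by (simp add: act_closed)

lemma cyclic_self:
  assumes "m \<in> carrier M"
  shows "m \<in> cyclic_gsubmodule G R M act m"
  using cyclic_single[OF assms M.R.one_closed G.one_closed] assms by (simp add: act_one)

lemma gsubmodule_cyclic:
  assumes m: "m \<in> carrier M"
  shows "gsubmodule G R M act (cyclic_gsubmodule G R M act m)" (is "gsubmodule _ _ _ _ ?C")
proof (rule gsubmoduleI)
  show "?C \<subseteq> carrier M"
  proof
    fix x assume "x \<in> ?C"
    with m show "x \<in> carrier M" by (induction rule: cyclic_induct) (auto simp: act_closed m)
  qed
  show "\<zero>\<^bsub>M\<^esub> \<in> ?C" by (rule cyclic_zero[OF m])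
  show "x \<oplus>\<^bsub>M\<^esub> y \<in> ?C" if "x \<in> ?C" "y \<in> ?C" for x y
    using cyclic_add[OF m that] .
  show "b \<odot>\<^bsub>M\<^esub> x \<in> ?C" if "b \<in> carrier R" "x \<in> ?C" for b x
    using m that(2)
  proof (induction rule: cyclic_induct)
    case zero
    then show ?case using cyclic_zero[OF m] that(1) by simp
  next
    case (step a g y)
    have "b \<odot>\<^bsub>M\<^esub> (a \<odot>\<^bsub>M\<^esub> act m g \<oplus>\<^bsub>M\<^esub> y)
        = (b \<otimes>\<^bsub>R\<^esub> a) \<odot>\<^bsub>M\<^esub> act m g \<oplus>\<^bsub>M\<^esub> b \<odot>\<^bsub>M\<^esub> y"
      using step that(1) m by (simp add: M.smult_r_distr M.smult_assoc1 act_closed)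
    also have "\<dots> \<in> ?C"
      by (intro cyclic_add[OF m cyclic_single[OF m]]) (use step that(1) in auto)
    finally show ?case .
  qed
  show "act x h \<in> ?C" if "x \<in> ?C" "h \<in> carrier G" for x h
    using m that(1)
  proof (induction rule: cyclic_induct)
    case zero
    then show ?case using cyclic_zero[OF m] that(2) by (simp add: act_zero)
  next
    case (step a g y)
    have "act (a \<odot>\<^bsub>M\<^esub> act m g \<oplus>\<^bsub>M\<^esub> y) h = a \<odot>\<^bsub>M\<^esub> act m (g \<otimes>\<^bsub>G\<^esub> h) \<oplus>\<^bsub>M\<^esub> act y h"
      using step that(2) m by (simp add: act_add act_smult act_mult act_closed)
    also have "\<dots> \<in> ?C"
      by (intro cyclic_add[OF m cyclic_single[OF m]]) (use step that(2) in auto)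
    finally show ?case .
  qed
qed

lemma right_gmodule_gsubmodule:
  assumes N: "gsubmodule G R M act N"
  shows "right_gmodule G R (M\<lparr>carrier := N\<rparr>) act"
proof -
  have "module R (M\<lparr>carrier := N\<rparr>)"
    by (rule submodule.submodule_is_module[OF gsubmoduleD(6)[OF N] M.module_axioms])
  then show ?thesis
    unfolding right_gmodule_def right_gmodule_axioms_def
    using gsubmoduleD(1,5)[OF N] G.group_axioms act_one act_mult act_add act_smult by (auto simp: subset_iff)
qed

text \<open>Makes results about submodules of the whole space available for submodules of
  \<open>N\<close>, as irreducibility requires.\<close>

lemma gsubmodule_trans:
  assumes N: "gsubmodule G R M act N" and W: "gsubmodule G R (M\<lparr>carrier := N\<rparr>) act W"
  shows "gsubmodule G R M act W"
proof -
  interpret N: right_gmodule G R "M\<lparr>carrier := N\<rparr>" act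
    by (rule right_gmodule_gsubmodule[OF N])
  show ?thesis
    using N.gsubmoduleD(1-5)[OF W] gsubmoduleD(1)[OF N] by (intro gsubmoduleI) auto
qed

lemma gsubmodule_restrict:
  assumes N: "gsubmodule G R M act N" and W: "gsubmodule G R M act W" "W \<subseteq> N"
  shows "gsubmodule G R (M\<lparr>carrier := N\<rparr>) act W"
proof -
  interpret N: right_gmodule G R "M\<lparr>carrier := N\<rparr>" act
    by (rule right_gmodule_gsubmodule[OF N])
  show ?thesis
    using gsubmoduleD(1-5)[OF W(1)] W(2) by (intro N.gsubmoduleI) auto
qed

lemma gsubmodule_Int:
  assumes "gsubmodule G R M act N" "gsubmodule G R M act W"
  shows "gsubmodule G R M act (N \<inter> W)"
  using gsubmoduleD(1-5)[OF assms(1)] gsubmoduleD(1-5)[OF assms(2)] by (intro gsubmoduleI) auto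

section \<open>Quotient modules\<close>

lemma gsubmodule_abelian_subgroup:
  assumes "gsubmodule G R M act H"
  shows "abelian_subgroup H M"
  using submodule.axioms(1)[OF gsubmoduleD(6)[OF assms]]
  by (intro abelian_subgroupI3 additive_subgroupI M.abelian_group_axioms)

text \<open>Scalars and group elements act on a coset by a union over its representatives. An
  additive map preserving \<open>H\<close> sends all of them into one coset, so the union collapses
  and the operations are well defined.\<close>

lemma UN_coset:
  assumes H: "gsubmodule G R M act H" and x: "x \<in> carrier M"
    and closed: "\<And>y. y \<in> carrier M \<Longrightarrow> f y \<in> carrier M" and f_H: "\<And>y. y \<in> H \<Longrightarrow> f y \<in> H"
    and add: "\<And>y z. \<lbrakk>y \<in> carrier M; z \<in> carrier M\<rbrakk> \<Longrightarrow> f (y \<oplus>\<^bsub>M\<^esub> z) = f y \<oplus>\<^bsub>M\<^esub> f z"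
  shows "(\<Union>y\<in>H +>\<^bsub>M\<^esub> x. H +>\<^bsub>M\<^esub> f y) = H +>\<^bsub>M\<^esub> f x"
proof -
  interpret H: abelian_subgroup H M by (rule gsubmodule_abelian_subgroup[OF H])
  have "H +>\<^bsub>M\<^esub> f y = H +>\<^bsub>M\<^esub> f x" if y: "y \<in> H +>\<^bsub>M\<^esub> x" for y
  proof -
    obtain h where h: "h \<in> H" "y = h \<oplus>\<^bsub>M\<^esub> x" using y by (auto simp: a_r_coset_def')
    then have "f y = f h \<oplus>\<^bsub>M\<^esub> f x" using add H.a_subset x by auto
    then have "f y \<in> H +>\<^bsub>M\<^esub> f x" using f_H[OF h(1)] by (auto simp: a_r_coset_def')
    then show ?thesis by (metis H.a_repr_independence' closed x)
  qed
  moreover have "x \<in> H +>\<^bsub>M\<^esub> x" by (rule H.a_rcos_self[OF x])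
  ultimately show ?thesis by blast
qed

context
  fixes H assumes H: "gsubmodule G R M act H"
begin

interpretation H: abelian_subgroup H M by (rule gsubmodule_abelian_subgroup[OF H])

lemma quot_carrier: "carrier (quot_module M H) = (\<lambda>x. H +>\<^bsub>M\<^esub> x) ` carrier M"
  by (auto simp: quot_module_def A_RCOSETS_def')

lemma quot_zero: "\<zero>\<^bsub>quot_module M H\<^esub> = H"
  by (simp add: quot_module_def)

lemma quot_add:
  "\<lbrakk>x \<in> carrier M; y \<in> carrier M\<rbrakk>
    \<Longrightarrow> (H +>\<^bsub>M\<^esub> x) \<oplus>\<^bsub>quot_module M H\<^esub> (H +>\<^bsub>M\<^esub> y) = H +>\<^bsub>M\<^esub> (x \<oplus>\<^bsub>M\<^esub> y)"
  by (simp add: quot_module_def H.a_rcos_sum)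

lemma quot_smult:
  assumes "a \<in> carrier R" "x \<in> carrier M"
  shows "a \<odot>\<^bsub>quot_module M H\<^esub> (H +>\<^bsub>M\<^esub> x) = H +>\<^bsub>M\<^esub> (a \<odot>\<^bsub>M\<^esub> x)"
  using UN_coset[OF H assms(2), of "\<lambda>x. a \<odot>\<^bsub>M\<^esub> x"] assms(1) gsubmoduleD(4)[OF H]
  by (simp add: quot_module_def M.smult_r_distr)

lemma quot_act:
  assumes "g \<in> carrier G" "x \<in> carrier M"
  shows "quot_act M H act (H +>\<^bsub>M\<^esub> x) g = H +>\<^bsub>M\<^esub> act x g"
  using UN_coset[OF H assms(2), of "\<lambda>x. act x g"] assms(1) gsubmoduleD(5)[OF H]
  by (simp add: quot_act_def act_closed act_add)

lemma abelian_group_quot: "abelian_group (quot_module M H)"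
proof -
  have H0: "H +>\<^bsub>M\<^esub> \<zero>\<^bsub>M\<^esub> = H" using H.a_subset by simp
  show ?thesis
  proof (rule abelian_groupI)
    show "\<zero>\<^bsub>quot_module M H\<^esub> \<in> carrier (quot_module M H)"
      by (metis H0 M.zero_closed image_eqI quot_carrier quot_zero)
    fix A assume "A \<in> carrier (quot_module M H)"
    then obtain x where x: "x \<in> carrier M" "A = H +>\<^bsub>M\<^esub> x" by (auto simp: quot_carrier)
    show "\<zero>\<^bsub>quot_module M H\<^esub> \<oplus>\<^bsub>quot_module M H\<^esub> A = A"
      using quot_add[of "\<zero>\<^bsub>M\<^esub>" x] x H0 by (simp add: quot_zero)
    have "(H +>\<^bsub>M\<^esub> (\<ominus>\<^bsub>M\<^esub> x)) \<oplus>\<^bsub>quot_module M H\<^esub> A = \<zero>\<^bsub>quot_module M H\<^esub>"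
      using x H0 by (simp add: quot_add quot_zero M.l_neg)
    then show "\<exists>B\<in>carrier (quot_module M H). B \<oplus>\<^bsub>quot_module M H\<^esub> A = \<zero>\<^bsub>quot_module M H\<^esub>"
      using x by (auto simp: quot_carrier)
  qed (auto simp: quot_carrier quot_add M.a_ac)
qed

lemma right_gmodule_quot: "right_gmodule G R (quot_module M H) (quot_act M H act)"
proof -
  have "module R (quot_module M H)"
    by (rule moduleI[OF M.R.is_cring abelian_group_quot])
       (auto simp: quot_carrier quot_smult quot_add M.smult_l_distr M.smult_r_distr M.smult_assoc1)
  then show ?thesis
    unfolding right_gmodule_def right_gmodule_axioms_def using G.group_axioms
    by (auto simp: quot_carrier quot_smult quot_add quot_act act_closed act_one act_mult act_add act_smult)
qed

text \<open>Correspondence theorem: a submodule \<open>W\<close> of the quotient pulls back to a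
  submodule \<open>U\<close> of \<open>M\<close>, and \<open>max\<close> forces \<open>U\<close>
  into \<open>H\<close> or makes it everything.\<close>

lemma irreducible_gmodule_quot:
  assumes ne: "H \<noteq> carrier M"
    and max: "\<And>U x. \<lbrakk>gsubmodule G R M act U; x \<in> U; x \<notin> H\<rbrakk> \<Longrightarrow> U = carrier M"
  shows "irreducible_gmodule G R (quot_module M H) (quot_act M H act)"
proof -
  interpret Q: right_gmodule G R "quot_module M H" "quot_act M H act" by (rule right_gmodule_quot)
  have HM: "H \<subseteq> carrier M" by (rule gsubmoduleD(1)[OF H])
  have coset_H: "H +>\<^bsub>M\<^esub> x = H \<longleftrightarrow> x \<in> H" if "x \<in> carrier M" for x
    using H.a_rcos_self[OF that] H.a_rcos_const[of x] by auto
  show ?thesis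
  proof
    obtain x where x: "x \<in> carrier M" "x \<notin> H" using ne HM by auto
    then show "carrier (quot_module M H) \<noteq> {\<zero>\<^bsub>quot_module M H\<^esub>}"
      using coset_H[of x] by (auto simp: quot_carrier quot_zero)
  next
    fix W assume W: "gsubmodule G R (quot_module M H) (quot_act M H act) W"
    note WD = Q.gsubmoduleD[OF W]
    define U where "U = {x \<in> carrier M. H +>\<^bsub>M\<^esub> x \<in> W}"
    have "gsubmodule G R M act U"
    proof (rule gsubmoduleI)
      show "\<zero>\<^bsub>M\<^esub> \<in> U" using WD(2) HM by (simp add: U_def quot_zero)
      show "x \<oplus>\<^bsub>M\<^esub> y \<in> U" if "x \<in> U" "y \<in> U" for x y
        using that WD(3)[of "H +>\<^bsub>M\<^esub> x" "H +>\<^bsub>M\<^esub> y"] by (simp add: U_def quot_add)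
      show "a \<odot>\<^bsub>M\<^esub> x \<in> U" if "a \<in> carrier R" "x \<in> U" for a x
        using that WD(4)[of a "H +>\<^bsub>M\<^esub> x"] by (simp add: U_def quot_smult)
      show "act x g \<in> U" if "x \<in> U" "g \<in> carrier G" for x g
        using that WD(5)[of "H +>\<^bsub>M\<^esub> x" g] by (simp add: U_def quot_act act_closed)
    qed (auto simp: U_def)
    then have U: "U \<subseteq> H \<or> U = carrier M" using max by blast
    \<comment> \<open>The quotient map is onto, so \<open>W\<close> is recovered from its
      preimage.\<close>
    have W_eq: "W = (\<lambda>x. H +>\<^bsub>M\<^esub> x) ` U"
      using WD(1) by (auto simp: U_def quot_carrier)
    show "W = {\<zero>\<^bsub>quot_module M H\<^esub>} \<or> W = carrier (quot_module M H)"
      using U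
    proof
      assume "U \<subseteq> H"
      then have "W \<subseteq> {H}" using coset_H HM by (auto simp: W_eq)
      then show ?thesis using WD(2) by (auto simp: quot_zero)
    qed (simp add: W_eq quot_carrier)
  qed
qed

end

end

section \<open>Structure vectors and the action of the general linear group\<close>

declare One_nat_def [simp del]

text \<open>The complements of the two pairs have equal size; a bijection between them is extended
  by the two prescribed values. It serves both to start a basis with two given vectors and to
  permute indices.\<close>

lemma bij_betw_prescribe_two:
  assumes "finite A" "finite B" "card A = card B"
    and "a \<in> A" "b \<in> A" "a \<noteq> b" "a' \<in> B" "b' \<in> B" "a' \<noteq> b'"
  obtains h where "bij_betw h A B" "h a = a'" "h b = b'"
proof -
  have "card (A - {a, b}) = card (B - {a', b'})"
    using assms by (simp add: card_Diff_subset)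
  then obtain h where h: "bij_betw h (A - {a, b}) (B - {a', b'})"
    using assms finite_same_card_bij by (metis finite_Diff)
  define h' where "h' = h(a := a', b := b')"
  have 1: "bij_betw h' (A - {a, b}) (B - {a', b'})"
    using h by (subst bij_betw_cong[of _ _ h]) (auto simp: h'_def)
  have 2: "bij_betw h' {a, b} {a', b'}"
    using assms by (auto simp: h'_def bij_betw_def)
  have "bij_betw h' ((A - {a, b}) \<union> {a, b}) ((B - {a', b'}) \<union> {a', b'})"
    by (rule bij_betw_combine[OF 1 2]) auto
  moreover have "(A - {a, b}) \<union> {a, b} = A" "(B - {a', b'}) \<union> {a', b'} = B"
    using assms by auto
  ultimately show ?thesis using that[of h'] assms by (auto simp: h'_def)
qed

lemma base_field_simps [simp]:
  "carrier base_field = UNIV" "\<zero>\<^bsub>base_field\<^esub> = 0" "\<one>\<^bsub>base_field\<^esub> = 1"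
  "x \<oplus>\<^bsub>base_field\<^esub> y = x + y" "x \<otimes>\<^bsub>base_field\<^esub> y = x * y"
  by (simp_all add: ring_of_type_algebra_def)

lemma Lambda_simps [simp]:
  "\<zero>\<^bsub>Lambda n\<^esub> = (\<lambda>i j k. 0)"
  "l \<oplus>\<^bsub>Lambda n\<^esub> l' = (\<lambda>i j k. l i j k + l' i j k)"
  "a \<odot>\<^bsub>Lambda n\<^esub> l = (\<lambda>i j k. a * l i j k)"
  by (simp_all add: Lambda_def)

lemma Lambda_eq_0:
  assumes "l \<in> carrier (Lambda n)" "i \<notin> {1..n} \<or> j \<notin> {1..n} \<or> k \<notin> {1..n}"
  shows "l i j k = 0"
  using assms by (auto simp: Lambda_def)

lemma Lambda_eqI:
  assumes "l \<in> carrier (Lambda n)" "l' \<in> carrier (Lambda n)"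
    and "\<And>i j k. \<lbrakk>i \<in> {1..n}; j \<in> {1..n}; k \<in> {1..n}\<rbrakk> \<Longrightarrow> l i j k = l' i j k"
  shows "l = l'"
proof (intro ext)
  fix i j k show "l i j k = l' i j k"
    using assms Lambda_eq_0[of l n i j k] Lambda_eq_0[of l' n i j k] by metis
qed

lemma module_Lambda: "module base_field (Lambda n :: ('f::field, nat \<Rightarrow> nat \<Rightarrow> nat \<Rightarrow> 'f) module)"
proof (rule moduleI)
  show "abelian_group (Lambda n :: ('f, nat \<Rightarrow> nat \<Rightarrow> nat \<Rightarrow> 'f) module)"
  proof (rule abelian_groupI)
    fix l :: "nat \<Rightarrow> nat \<Rightarrow> nat \<Rightarrow> 'f" assume "l \<in> carrier (Lambda n)"
    then show "\<exists>l'\<in>carrier (Lambda n). l' \<oplus>\<^bsub>Lambda n\<^esub> l = \<zero>\<^bsub>Lambda n\<^esub>"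
      by (intro bexI[of _ "\<lambda>i j k. - l i j k"]) (auto simp: Lambda_def)
  qed (auto simp: Lambda_def algebra_simps intro!: ext, (metis add_0)+)
qed (auto simp: Lambda_def algebra_simps cring_from_type_algebra)

context based_vector_space
begin

sublocale finite_dimensional_vector_space scale "v ` {1..n}"
  by unfold_locales (use basis_independent basis_span in auto)

lemma coord_add [simp]: "coord (x + y) i = coord x i + coord y i"
  and coord_scale [simp]: "coord (a *s x) i = a * coord x i"
  and coord_0 [simp]: "coord 0 i = 0"
  and coord_diff [simp]: "coord (x - y) i = coord x i - coord y i"
  by (simp_all add: coord_def representation_add representation_scale representation_zero
      representation_diff basis_independent basis_span)

lemma coord_sum [simp]: "coord (sum f S) i = (\<Sum>s\<in>S. coord (f s) i)"
  by (induction S rule: infinite_finite_induct) auto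

lemma coord_basis [simp]:
  assumes "i \<in> {1..n}" "j \<in> {1..n}"
  shows "coord (v i) j = (if i = j then 1 else 0)"
  using assms inj_on_eq_iff[OF basis_inj assms(2,1)]
  by (simp add: coord_def representation_basis basis_independent)

lemma sum_coord: "(\<Sum>i\<in>{1..n}. coord x i *s v i) = x"
proof -
  have "(\<Sum>b\<in>v ` {1..n}. representation (v ` {1..n}) x b *s b) = x"
    by (rule sum_representation_eq) (use basis_independent basis_span in auto)
  then show ?thesis by (simp add: sum.reindex[OF basis_inj] coord_def)
qed

lemma coord_eqI:
  assumes "\<And>k. k \<in> {1..n} \<Longrightarrow> coord x k = coord y k"
  shows "x = y"
proof -
  have "(\<Sum>i\<in>{1..n}. coord x i *s v i) = (\<Sum>i\<in>{1..n}. coord y i *s v i)"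
    by (rule sum.cong) (simp_all add: assms)
  then show ?thesis by (simp only: sum_coord)
qed

lemma coord_bracket:
  assumes "k \<in> {1..n}"
  shows "coord (bracket l x y) k = (\<Sum>i\<in>{1..n}. \<Sum>j\<in>{1..n}. coord x i * coord y j * l i j k)"
proof -
  have "(\<Sum>m\<in>{1..n}. l i j m * coord (v m) k) = l i j k" for i j
  proof -
    have "(\<Sum>m\<in>{1..n}. l i j m * coord (v m) k) = (\<Sum>m\<in>{1..n}. if m = k then l i j k else 0)"
      using assms by (intro sum.cong) auto
    also have "\<dots> = l i j k" using assms by simp
    finally show ?thesis .
  qed
  then show ?thesis by (simp add: bracket_def)
qed

lemma bracket_add_left: "bracket l (x + x') y = bracket l x y + bracket l x' y"
  and bracket_add_right: "bracket l x (y + y') = bracket l x y + bracket l x y'"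
  and bracket_scale_left: "bracket l (a *s x) y = a *s bracket l x y"
  and bracket_scale_right: "bracket l x (a *s y) = a *s bracket l x y"
  by (rule coord_eqI; simp add: coord_bracket algebra_simps sum.distrib sum_distrib_left)+

lemma bracket_0 [simp]: "bracket l 0 y = 0" "bracket l x 0 = 0"
  by (rule coord_eqI; simp add: coord_bracket)+

lemma bracket_sum_left: "bracket l (sum f S) y = (\<Sum>s\<in>S. bracket l (f s) y)"
  and bracket_sum_right: "bracket l x (sum f S) = (\<Sum>s\<in>S. bracket l x (f s))"
  by (induction S rule: infinite_finite_induct; simp add: bracket_add_left bracket_add_right)+

lemma bracket_plus: "bracket (\<lambda>i j k. l i j k + l' i j k) x y = bracket l x y + bracket l' x y"
  and bracket_smult: "bracket (\<lambda>i j k. a * l i j k) x y = a *s bracket l x y"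
  and bracket_zero [simp]: "bracket (\<lambda>i j k. 0) x y = 0"
  by (rule coord_eqI; simp add: coord_bracket algebra_simps sum.distrib sum_distrib_left)+

lemma sum_coord_basis:
  assumes "j \<in> {1..n}"
  shows "(\<Sum>q\<in>{1..n}. coord (v j) q * c q) = c j"
proof -
  have "(\<Sum>q\<in>{1..n}. coord (v j) q * c q) = (\<Sum>q\<in>{1..n}. if q = j then c j else 0)"
    by (rule sum.cong) (use assms in auto)
  then show ?thesis using assms by simp
qed

lemma coord_bracket_basis:
  assumes "i \<in> {1..n}" "j \<in> {1..n}" "k \<in> {1..n}"
  shows "coord (bracket l (v i) (v j)) k = l i j k"
  unfolding coord_bracket[OF assms(3)] mult.assoc sum_distrib_left[symmetric]
  by (simp only: sum_coord_basis assms)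

lemma Lambda_eqI_bracket:
  assumes "l \<in> carrier (Lambda n)" "l' \<in> carrier (Lambda n)"
    and "\<And>x y. bracket l x y = bracket l' x y"
  shows "l = l'"
  using assms by (intro Lambda_eqI) (auto simp flip: coord_bracket_basis)

text \<open>Expand both arguments in the basis. This identifies an abstractly given product with the
  one defined by a structure vector.\<close>

lemma bilinear_eqI:
  assumes "\<And>x x' y. p (x + x') y = p x y + p x' y" "\<And>a x y. p (a *s x) y = a *s p x y"
    and "\<And>x y y'. p x (y + y') = p x y + p x y'" "\<And>a x y. p x (a *s y) = a *s p x y"
    and "\<And>i j. \<lbrakk>i \<in> {1..n}; j \<in> {1..n}\<rbrakk> \<Longrightarrow> p (v i) (v j) = bracket l (v i) (v j)"
  shows "p x y = bracket l x y"
proof -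
  have z: "p 0 y = 0" "p x 0 = 0" for x y using assms(2)[of 0 0 y] assms(4)[of x 0 0] by auto
  have s1: "p (sum f S) y = (\<Sum>s\<in>S. p (f s) y)" for f :: "nat \<Rightarrow> 'v" and S y
    by (induction S rule: infinite_finite_induct) (auto simp: z assms(1))
  have s2: "p x (sum f S) = (\<Sum>s\<in>S. p x (f s))" for f :: "nat \<Rightarrow> 'v" and S x
    by (induction S rule: infinite_finite_induct) (auto simp: z assms(3))
  have "p (\<Sum>i\<in>{1..n}. coord x i *s v i) (\<Sum>i\<in>{1..n}. coord y i *s v i)
      = bracket l (\<Sum>i\<in>{1..n}. coord x i *s v i) (\<Sum>i\<in>{1..n}. coord y i *s v i)"
    by (simp only: s1 s2 assms(2,4) bracket_sum_left bracket_sum_right bracket_scale_left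
        bracket_scale_right) (intro sum.cong refl, simp add: assms(5))
  then show ?thesis by (simp only: sum_coord)
qed

section \<open>The general linear group and its action\<close>

lemma structure_vector_in_Lambda: "structure_vector p \<in> carrier (Lambda n)"
  by (auto simp: structure_vector_def Lambda_def)

lemma GL_D:
  assumes "g \<in> carrier GL"
  shows "g (x + y) = g x + g y" "g (a *s x) = a *s g x" "bij g"
    "g (inv_into UNIV g x) = x" "inv_into UNIV g (g x) = x"
    "inv_into UNIV g (x + y) = inv_into UNIV g x + inv_into UNIV g y" "inv_into UNIV g (a *s x) = a *s inv_into UNIV g x"
proof -
  have lin: "g (x + y) = g x + g y" "g (a *s x) = a *s g x" for x y a
    using assms by (simp_all add: GL_def Vector_Spaces.linear_iff)
  have bij: "bij g" using assms by (simp add: GL_def)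
  have inv: "g (inv_into UNIV g x) = x" "inv_into UNIV g (g x) = x" for x
    using bij by (simp_all add: bij_is_surj surj_f_inv_f bij_is_inj)
  show "inv_into UNIV g (x + y) = inv_into UNIV g x + inv_into UNIV g y" "inv_into UNIV g (a *s x) = a *s inv_into UNIV g x"
    by (metis lin(1) inv, metis lin(2) inv)
  show "g (x + y) = g x + g y" "g (a *s x) = a *s g x" "bij g"
    "g (inv_into UNIV g x) = x" "inv_into UNIV g (g x) = x"
    by (rule lin bij inv)+
qed

lemma GL_I:
  assumes "\<And>x y. g (x + y) = g x + g y" "\<And>a x. g (a *s x) = a *s g x" "bij g"
  shows "g \<in> carrier GL"
  using assms by (simp add: GL_def Vector_Spaces.linear_iff vector_space_axioms)

lemma GL_simps [simp]: "\<one>\<^bsub>GL\<^esub> = id" "g \<otimes>\<^bsub>GL\<^esub> h = g \<circ> h"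
  by (simp_all add: GL_def)

lemma id_in_GL: "id \<in> carrier GL"
  by (rule GL_I) auto

lemma comp_in_GL: "\<lbrakk>g \<in> carrier GL; h \<in> carrier GL\<rbrakk> \<Longrightarrow> g \<circ> h \<in> carrier GL"
  by (rule GL_I) (auto simp: GL_D intro: bij_comp)

lemma inv_in_GL: "g \<in> carrier GL \<Longrightarrow> inv_into UNIV g \<in> carrier GL"
  by (rule GL_I) (auto simp: GL_D intro: bij_imp_bij_inv)

lemma group_GL: "group GL"
proof (rule groupI)
  fix g assume g: "g \<in> carrier GL"
  show "\<exists>h\<in>carrier GL. h \<otimes>\<^bsub>GL\<^esub> g = \<one>\<^bsub>GL\<^esub>"
    using inv_in_GL[OF g] GL_D(3)[OF g] by (auto intro!: bexI[of _ "inv_into UNIV g"] simp: bij_is_inj)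
qed (auto simp: comp_in_GL id_in_GL[unfolded id_def] id_in_GL o_assoc)

text \<open>\<open>act\<close> only records products of basis vectors; bilinearity recovers the
  whole product. Identities between structure vectors thereby become identities between
  products.\<close>

lemma bracket_act:
  assumes g: "g \<in> carrier GL"
  shows "bracket (act l g) x y = inv_into UNIV g (bracket l (g x) (g y))"
proof (rule sym, rule bilinear_eqI)
  fix i j assume ij: "i \<in> {1..n}" "j \<in> {1..n}"
  show "inv_into UNIV g (bracket l (g (v i)) (g (v j))) = bracket (act l g) (v i) (v j)"
    using ij by (intro coord_eqI) (simp add: coord_bracket_basis act_def structure_vector_def)
qed (auto simp: GL_D[OF g] bracket_add_left bracket_add_right bracket_scale_left bracket_scale_right)

lemma act_in_Lambda: "act l g \<in> carrier (Lambda n)"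
  by (simp add: act_def structure_vector_in_Lambda)

lemma right_gmodule_Lambda: "right_gmodule GL base_field (Lambda n) act"
  unfolding right_gmodule_def right_gmodule_axioms_def
proof (intro conjI allI impI group_GL module_Lambda act_in_Lambda)
  fix l l' :: "nat \<Rightarrow> nat \<Rightarrow> nat \<Rightarrow> 'f" and g h a
  interpret module base_field "Lambda n :: ('f, nat \<Rightarrow> nat \<Rightarrow> nat \<Rightarrow> 'f) module"
    by (rule module_Lambda)
  assume l: "l \<in> carrier (Lambda n)"
  then show "act l \<one>\<^bsub>GL\<^esub> = l"
    by (intro Lambda_eqI_bracket act_in_Lambda) (simp_all add: bracket_act id_in_GL)
  assume g: "g \<in> carrier GL"
  show "act (a \<odot>\<^bsub>Lambda n\<^esub> l) g = a \<odot>\<^bsub>Lambda n\<^esub> act l g"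
    using smult_closed[OF _ act_in_Lambda, of a] g
    by (intro Lambda_eqI_bracket act_in_Lambda) (simp_all add: bracket_act bracket_smult GL_D)
  show "act (l \<oplus>\<^bsub>Lambda n\<^esub> l') g = act l g \<oplus>\<^bsub>Lambda n\<^esub> act l' g"
    using M.add.m_closed[OF act_in_Lambda act_in_Lambda] g
    by (intro Lambda_eqI_bracket act_in_Lambda) (simp_all add: bracket_act bracket_plus GL_D)
  assume h: "h \<in> carrier GL"
  \<comment> \<open>Inversion reverses composition, which makes this a right action.\<close>
  show "act l (g \<otimes>\<^bsub>GL\<^esub> h) = act (act l g) h"
    using g h by (intro Lambda_eqI_bracket act_in_Lambda)
      (simp_all add: bracket_act comp_in_GL o_inv_distrib GL_D)
qed

sublocale Lam: right_gmodule GL base_field "Lambda n" act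
  by (rule right_gmodule_Lambda)

text \<open>The trace is read off a fixed basis; its invariance comes from trace(hk) = trace(kh),
  proved by swapping the double sum of matrix entries.\<close>

lemma trace_conj:
  assumes g: "g \<in> carrier GL"
    and f: "\<And>x y. f (x + y) = f x + f y" "\<And>a x. f (a *s x) = a *s f x"
  shows "trace (\<lambda>x. inv_into UNIV g (f (g x))) = trace f"
proof -
  have expand: "coord (h x) i = (\<Sum>j\<in>{1..n}. coord x j * coord (h (v j)) i)"
    if "\<And>x y. h (x + y) = h x + h y" "\<And>a x. h (a *s x) = a *s h x" for h x i
  proof -
    have "h 0 = 0" using that(2)[of 0 0] by simp
    then have "h (sum F S) = (\<Sum>s\<in>S. h (F s))" for F :: "nat \<Rightarrow> 'v" and S
      by (induction S rule: infinite_finite_induct) (auto simp: that(1))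
    then have "h (\<Sum>j\<in>{1..n}. coord x j *s v j) = (\<Sum>j\<in>{1..n}. coord x j *s h (v j))"
      by (simp add: that(2))
    then show ?thesis by (simp add: sum_coord)
  qed
  have comm: "trace (\<lambda>x. h (k x)) = trace (\<lambda>x. k (h x))"
    if h: "\<And>x y. h (x + y) = h x + h y" "\<And>a x. h (a *s x) = a *s h x"
      and k: "\<And>x y. k (x + y) = k x + k y" "\<And>a x. k (a *s x) = a *s k x" for h k
  proof -
    have "trace (\<lambda>x. h (k x)) = (\<Sum>i\<in>{1..n}. \<Sum>j\<in>{1..n}. coord (k (v i)) j * coord (h (v j)) i)"
      unfolding trace_def by (subst expand[of h, OF h]) simp
    also have "\<dots> = (\<Sum>j\<in>{1..n}. \<Sum>i\<in>{1..n}. coord (h (v j)) i * coord (k (v i)) j)"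
      by (subst sum.swap) (simp add: mult.commute)
    also have "\<dots> = trace (\<lambda>x. k (h x))"
      unfolding trace_def by (subst expand[of k, OF k]) simp
    finally show ?thesis .
  qed
  have "trace (\<lambda>x. inv_into UNIV g (f (g x))) = trace (\<lambda>x. f (g (inv_into UNIV g x)))"
    by (rule comm) (auto simp: GL_D[OF g] f)
  then show ?thesis by (simp add: GL_D[OF g])
qed

section \<open>Invariance of the submodules in the statement\<close>

lemma gsubmodule_C: "gsubmodule GL base_field (Lambda n) act C_mod"
  using Lam.M.add.m_closed Lam.M.smult_closed Lam.M.zero_closed
  by (intro Lam.gsubmoduleI)
     (auto simp: C_mod_def bracket_plus bracket_smult bracket_act act_in_Lambda)

lemma gsubmodule_T: "gsubmodule GL base_field (Lambda n) act T_mod"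
proof (rule Lam.gsubmoduleI)
  fix l g assume "l \<in> T_mod" and g: "g \<in> carrier GL"
  \<comment> \<open>Multiplication by \<open>x\<close> in the transformed product is the conjugate
    by \<open>g\<close> of multiplication by \<open>g x\<close> in the old one.\<close>
  then show "act l g \<in> T_mod"
    using trace_conj[OF g, of "bracket l (g x)" for x]
    by (simp add: T_mod_def act_in_Lambda bracket_act[OF g, abs_def] bracket_add_right bracket_scale_right)
qed (use Lam.M.add.m_closed Lam.M.smult_closed Lam.M.zero_closed in
    \<open>auto simp: T_mod_def trace_def bracket_plus bracket_smult sum.distrib simp flip: sum_distrib_left\<close>)

lemma gsubmodule_Mss: "gsubmodule GL base_field (Lambda n) act Mss_mod"
proof (rule Lam.gsubmoduleI)
  fix l l' assume *: "l \<in> Mss_mod" "l' \<in> Mss_mod"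
  have "\<exists>a. bracket l x x + bracket l' x x = a *s x" for x
  proof -
    obtain a b where "bracket l x x = a *s x" "bracket l' x x = b *s x"
      using * unfolding Mss_mod_def by blast
    then show ?thesis by (intro exI[of _ "a + b"]) (simp add: scale_left_distrib)
  qed
  then show "l \<oplus>\<^bsub>Lambda n\<^esub> l' \<in> Mss_mod"
    using * Lam.M.add.m_closed[of l l'] by (simp add: Mss_mod_def bracket_plus)
next
  fix a l assume *: "l \<in> Mss_mod"
  have "\<exists>b. a *s bracket l x x = b *s x" for x
  proof -
    obtain b where "bracket l x x = b *s x" using * by (auto simp: Mss_mod_def)
    then show ?thesis by (intro exI[of _ "a * b"]) simp
  qed
  then show "a \<odot>\<^bsub>Lambda n\<^esub> l \<in> Mss_mod"
    using * Lam.M.smult_closed[of a l] by (simp add: Mss_mod_def bracket_smult)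
next
  fix l g assume *: "l \<in> Mss_mod" and g: "g \<in> carrier GL"
  have "\<exists>b. inv_into UNIV g (bracket l (g x) (g x)) = b *s x" for x
  proof -
    obtain b where "bracket l (g x) (g x) = b *s g x" using * by (auto simp: Mss_mod_def)
    then show ?thesis by (auto simp: GL_D[OF g])
  qed
  then show "act l g \<in> Mss_mod"
    by (simp add: Mss_mod_def bracket_act[OF g] act_in_Lambda)
next
  have "\<exists>a. 0 = a *s x" for x by (rule exI[of _ 0]) simp
  then show "\<zero>\<^bsub>Lambda n\<^esub> \<in> Mss_mod"
    using Lam.M.zero_closed by (simp add: Mss_mod_def)
qed (auto simp: Mss_mod_def)

lemma gsubmodule_N: "gsubmodule GL base_field (Lambda n) act N_mod"
  unfolding N_mod_def by (rule Lam.gsubmodule_Int[OF gsubmodule_C gsubmodule_T])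

end

section \<open>Generation of N\<close>

definition unit_vec :: "nat \<Rightarrow> nat \<Rightarrow> nat \<Rightarrow> nat \<Rightarrow> nat \<Rightarrow> nat \<Rightarrow> 'f::field"
  where "unit_vec i j k p q r = (if p = i \<and> q = j \<and> r = k then 1 else 0)"

lemma delta_eq_unit_vec: "delta = unit_vec 1 1 2"
  by (intro ext) (simp add: delta_def unit_vec_def)

lemma unit_vec_in_Lambda:
  "\<lbrakk>i \<in> {1..n}; j \<in> {1..n}; k \<in> {1..n}\<rbrakk> \<Longrightarrow> unit_vec i j k \<in> carrier (Lambda n)"
  by (auto simp: unit_vec_def Lambda_def)

definition sym_vec :: "nat \<Rightarrow> nat \<Rightarrow> nat \<Rightarrow> nat \<Rightarrow> nat \<Rightarrow> nat \<Rightarrow> 'f::field"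
  where "sym_vec i j k p q r = unit_vec i j k p q r + unit_vec j i k p q r"

text \<open>Together with the vectors \<open>unit_vec i i k\<close> (\<open>i \<noteq> k\<close>) and \<open>sym_vec i j k\<close> (\<open>i, j, k\<close> distinct)
  these trace-zero combinations span \<open>N\<close>.\<close>

definition tr_vec :: "nat \<Rightarrow> nat \<Rightarrow> nat \<Rightarrow> nat \<Rightarrow> nat \<Rightarrow> 'f::field"
  where "tr_vec i j p q r = sym_vec i j j p q r - unit_vec i i i p q r"

text \<open>The size of the field enters through such an element: \<open>t - t * t\<close> is then
  invertible, and it is the denominator in both interpolations below.\<close>

lemma field_elem_not_0_1:
  assumes "infinite (UNIV :: 'f::field set) \<or> card (UNIV :: 'f::field set) > 2"
  obtains t :: "'f::field" where "t \<noteq> 0" "t \<noteq> 1"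
proof -
  have "\<not> (UNIV :: 'f set) \<subseteq> {0, 1}"
  proof
    assume *: "(UNIV :: 'f set) \<subseteq> {0, 1}"
    then have "finite (UNIV :: 'f set)" by (rule finite_subset) simp
    moreover have "card (UNIV :: 'f set) \<le> card {0, 1 :: 'f}" by (rule card_mono) (use * in auto)
    ultimately show False using assms by simp
  qed
  then show ?thesis using that by auto
qed

context based_vector_space
begin

section \<open>Transvections and changes of basis\<close>

definition transvection :: "('v \<Rightarrow> 'f) \<Rightarrow> 'v \<Rightarrow> 'v \<Rightarrow> 'v"
  where "transvection \<phi> w x = x + \<phi> x *s w"

text \<open>Since \<open>\<phi> w = 0\<close>, moving along \<open>w\<close> does not change
  \<open>\<phi>\<close>, so subtracting \<open>\<phi> x *s w\<close> undoes the map.\<close>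

lemma transvection_in_GL:
  assumes add: "\<And>x y. \<phi> (x + y) = \<phi> x + \<phi> y" and scale: "\<And>a x. \<phi> (a *s x) = a * \<phi> x"
    and "\<phi> w = 0"
  shows "transvection \<phi> w \<in> carrier GL"
    and inv_transvection: "inv_into UNIV (transvection \<phi> w) x = x - \<phi> x *s w"
proof -
  have neg: "\<phi> (x - a *s w) = \<phi> x" for x a
    using add[of "x - a *s w" "a *s w"] scale[of a w] assms(3) by simp
  have l: "transvection \<phi> w (x - \<phi> x *s w) = x" for x
    by (simp add: transvection_def neg)
  have r: "transvection \<phi> w x - \<phi> (transvection \<phi> w x) *s w = x" for x
    by (simp add: transvection_def add scale assms(3))
  have bij: "bij (transvection \<phi> w)"
    by (rule bij_betw_byWitness[where f' = "\<lambda>x. x - \<phi> x *s w"]) (auto simp: l r)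
  show "transvection \<phi> w \<in> carrier GL"
    by (rule GL_I[OF _ _ bij]) (simp_all add: transvection_def add scale algebra_simps
        scale_right_distrib scale_left_distrib)
  show "inv_into UNIV (transvection \<phi> w) x = x - \<phi> x *s w"
    using bij by (intro inv_f_eq) (auto simp: l bij_is_inj)
qed

text \<open>The range of the linear extension contains \<open>n\<close> independent vectors, hence
  is everything; in finite dimension surjectivity gives injectivity.\<close>

lemma GL_exists_basis_change:
  assumes inj: "inj_on u {1..n}" and ind: "independent (u ` {1..n})"
  obtains g where "g \<in> carrier GL" "\<And>i. i \<in> {1..n} \<Longrightarrow> g (v i) = u i"
proof -
  interpret P: vector_space_pair scale scale ..
  obtain g where g: "Vector_Spaces.linear scale scale g"
    and gv: "\<forall>x\<in>v ` {1..n}. g x = u (inv_into {1..n} v x)"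
    using P.linear_independent_extend[OF basis_independent, of "\<lambda>x. u (inv_into {1..n} v x)"] by blast
  have gu: "g (v i) = u i" if "i \<in> {1..n}" for i
    using gv that basis_inj by simp
  have "card (u ` {1..n}) = dimension"
    by (simp add: card_image inj basis_inj dimension_def)
  then have "span (u ` {1..n}) = UNIV"
    using card_ge_dim_independent[of "u ` {1..n}" UNIV] ind by (auto simp: dimension_def)
  moreover have "u ` {1..n} \<subseteq> range g" using gu by (metis image_subsetI rangeI)
  moreover have "subspace (range g)"
    using P.linear_subspace_image[OF g subspace_UNIV] .
  ultimately have "surj g" using span_minimal by (metis top.extremum_uniqueI)
  then have "bij g" using linear_surj_imp_inj[OF g] by (simp add: bij_def)
  then have "g \<in> carrier GL" using g by (simp add: GL_def)
  then show ?thesis using that gu by blast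
qed

text \<open>Used to normalise a vector and its square, when independent, to \<open>v 1\<close> and
  \<open>v 2\<close>.\<close>

lemma GL_exists_extend_pair:
  assumes n: "2 \<le> n" and xz: "x \<noteq> z" "independent {x, z}"
  obtains g where "g \<in> carrier GL" "g (v 1) = x" "g (v 2) = z"
proof -
  define B where "B = extend_basis {x, z}"
  have B: "independent B" "{x, z} \<subseteq> B" "span B = UNIV"
    unfolding B_def using xz(2)
    by (rule independent_extend_basis, rule extend_basis_superset, rule span_extend_basis)
  have "card B = card (v ` {1..n})"
    using basis_card_eq_dim[of B UNIV] B by (simp add: dimension_def)
  then have "card {1..n} = card B" by (simp add: card_image basis_inj)
  then obtain u where u: "bij_betw u {1..n} B" "u 1 = x" "u 2 = z"
    by (rule bij_betw_prescribe_two[rotated 2, of _ _ 1 2 x z])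
       (use n B xz finiteI_independent[OF B(1)] in auto)
  then have "inj_on u {1..n}" "independent (u ` {1..n})"
    using B(1) by (auto simp: bij_betw_def)
  then show ?thesis using that u n by (elim GL_exists_basis_change) auto
qed

lemma GL_exists_permutation:
  assumes "i \<in> {1..n}" "k \<in> {1..n}" "i \<noteq> k" "i' \<in> {1..n}" "k' \<in> {1..n}" "i' \<noteq> k'"
  obtains g h where "g \<in> carrier GL" "bij_betw h {1..n} {1..n}" "h i = i'" "h k = k'"
    "\<And>j. j \<in> {1..n} \<Longrightarrow> g (v j) = v (h j)"
proof -
  obtain h where h: "bij_betw h {1..n} {1..n}" "h i = i'" "h k = k'"
    by (rule bij_betw_prescribe_two[of "{1..n}" "{1..n}" i k i' k']) (use assms in auto)
  have "inj_on (v \<circ> h) {1..n}" "(v \<circ> h) ` {1..n} = v ` {1..n}"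
    using h(1) basis_inj by (simp_all only: bij_betw_def comp_inj_on image_comp[symmetric])
  then obtain g where "g \<in> carrier GL" "\<And>j. j \<in> {1..n} \<Longrightarrow> g (v j) = (v \<circ> h) j"
    using GL_exists_basis_change[of "v \<circ> h"] basis_independent by metis
  then show ?thesis using that[of g h] h by simp
qed

section \<open>Elementary structure vectors and a decomposition of \<open>N_mod\<close>\<close>

lemma bracket_unit_vec:
  assumes "i \<in> {1..n}" "j \<in> {1..n}" "k \<in> {1..n}"
  shows "bracket (unit_vec i j k) x y = (coord x i * coord y j) *s v k"
  by (rule bilinear_eqI[symmetric])
     (use assms in \<open>auto simp: algebra_simps scale_left_distrib coord_bracket_basis unit_vec_def intro!: coord_eqI\<close>)

text \<open>An elementary structure vector is a pure tensor of two coordinate functionals and a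
  basis vector: the functionals are composed with \<open>g\<close>, the vector is moved by its
  inverse.\<close>

lemma act_unit_vec:
  assumes "i \<in> {1..n}" "j \<in> {1..n}" "k \<in> {1..n}" "p \<in> {1..n}" "q \<in> {1..n}" "r \<in> {1..n}"
    and g: "g \<in> carrier GL"
  shows "act (unit_vec i j k) g p q r = coord (g (v p)) i * coord (g (v q)) j * coord (inv_into UNIV g (v k)) r"
  using assms by (simp add: act_def structure_vector_def bracket_unit_vec GL_D)

text \<open>The operators of this product have image in the line of \<open>v k\<close> and read only
  the coordinate \<open>i\<close>; as \<open>i \<noteq> k\<close>, their diagonal is zero.\<close>

lemma unit_vec_in_N:
  assumes "i \<in> {1..n}" "k \<in> {1..n}" "i \<noteq> k"
  shows "unit_vec i i k \<in> N_mod"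
proof -
  have "trace (bracket (unit_vec i i k) x) = 0" for x
    using assms by (auto simp: trace_def bracket_unit_vec intro!: sum.neutral)
  then show ?thesis
    using assms by (simp add: N_mod_def C_mod_def T_mod_def unit_vec_in_Lambda bracket_unit_vec mult.commute)
qed

lemma unit_vec_not_in_Mss:
  assumes "i \<in> {1..n}" "k \<in> {1..n}" "i \<noteq> k"
  shows "unit_vec i i k \<notin> Mss_mod"
proof
  assume "unit_vec i i k \<in> Mss_mod"
  then obtain a where "bracket (unit_vec i i k) (v i) (v i) = a *s v i" by (auto simp: Mss_mod_def)
  then have "coord (bracket (unit_vec i i k) (v i) (v i)) k = coord (a *s v i) k" by simp
  then show False using assms by (simp add: coord_bracket_basis unit_vec_def)
qed

lemma N_mod_sym:
  assumes "l \<in> N_mod"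
  shows "l i j k = l j i k"
proof (cases "i \<in> {1..n} \<and> j \<in> {1..n} \<and> k \<in> {1..n}")
  case True
  have "bracket l (v i) (v j) = bracket l (v j) (v i)" using assms by (simp add: N_mod_def C_mod_def)
  then show ?thesis using True by (metis coord_bracket_basis)
next
  case False
  have "l \<in> carrier (Lambda n)" using assms by (simp add: N_mod_def C_mod_def)
  then show ?thesis using False Lambda_eq_0 by metis
qed

text \<open>The diagonal entries are determined by the others, so the decomposition of
  \<open>l\<close> carries no coefficients for them.\<close>

lemma N_mod_trace:
  assumes "l \<in> N_mod" "i \<in> {1..n}"
  shows "l i i i = - (\<Sum>j\<in>{1..n} - {i}. l i j j)"
proof -
  have "(\<Sum>j\<in>{1..n}. l i j j) = trace (bracket l (v i))"
    unfolding trace_def using assms(2) by (intro sum.cong) (simp_all add: coord_bracket_basis)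
  also have "\<dots> = 0" using assms(1) by (simp add: N_mod_def T_mod_def)
  finally have "(\<Sum>j\<in>{1..n}. l i j j) = 0" .
  then have "l i i i + (\<Sum>j\<in>{1..n} - {i}. l i j j) = 0" using assms(2) by (simp add: sum.remove)
  then show ?thesis by (simp add: eq_neg_iff_add_eq_0)
qed

text \<open>The index patterns are treated separately. \<open>Q\<close> requires
  \<open>i < j\<close> so that each symmetric pair is counted once; the correction term inside
  \<open>tr_vec\<close> reproduces the diagonal by the trace condition.\<close>

lemma N_mod_decomposition:
  fixes l :: "nat \<Rightarrow> nat \<Rightarrow> nat \<Rightarrow> 'f"
  defines "P \<equiv> {(i, k). i \<in> {1..n} \<and> k \<in> {1..n} \<and> i \<noteq> k}"
    and "Q \<equiv> {(i, j, k). i \<in> {1..n} \<and> j \<in> {1..n} \<and> k \<in> {1..n} \<and> i < j \<and> k \<noteq> i \<and> k \<noteq> j}"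
  assumes l: "l \<in> N_mod" and pqr: "p \<in> {1..n}" "q \<in> {1..n}" "r \<in> {1..n}"
  shows "l p q r = (\<Sum>(i, k)\<in>P. l i i k * unit_vec i i k p q r)
    + (\<Sum>(i, j, k)\<in>Q. l i j k * sym_vec i j k p q r) + (\<Sum>(i, j)\<in>P. l i j j * tr_vec i j p q r)"
proof -
  have "P \<subseteq> {1..n} \<times> {1..n}" "Q \<subseteq> {1..n} \<times> {1..n} \<times> {1..n}" by (auto simp: P_def Q_def)
  then have fin: "finite P" "finite Q" by (auto intro: finite_subset)
  have 1: "(\<Sum>(i, k)\<in>P. l i i k * unit_vec i i k p q r) = (if p = q \<and> p \<noteq> r then l p q r else 0)"
  proof -
    have "(\<Sum>(i, k)\<in>P. l i i k * unit_vec i i k p q r)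
        = (\<Sum>s\<in>P. if s = (p, r) then (if p = q then l p q r else 0) else 0)"
      by (intro sum.cong) (auto simp: unit_vec_def split: if_splits)
    then show ?thesis using fin pqr by (auto simp: P_def)
  qed
  have 2: "(\<Sum>(i, j, k)\<in>Q. l i j k * sym_vec i j k p q r)
      = (if p \<noteq> q \<and> r \<noteq> p \<and> r \<noteq> q then l p q r else 0)"
  proof -
    \<comment> \<open>The sorted pair is the only representative of the two indices that can occur
      in \<open>Q\<close>; for \<open>p = q\<close> there is none.\<close>
    have "l i j k * sym_vec i j k p q r = (if (i, j, k) = (min p q, max p q, r) then l p q r else 0)"
      if ij: "(i, j, k) \<in> Q" for i j k
    proof -
      have "i < j" using ij by (simp add: Q_def)
      then consider "p = i" "q = j" "r = k" | "p = j" "q = i" "r = k"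
        | "\<not> (p = i \<and> q = j \<and> r = k)" "\<not> (p = j \<and> q = i \<and> r = k)"
          "(i, j, k) \<noteq> (min p q, max p q, r)"
        by (cases "p \<le> q") (auto simp: min_def max_def)
      then show ?thesis
      proof cases
        case 2
        then show ?thesis
          using \<open>i < j\<close> N_mod_sym[OF l, of i j k] by (simp add: sym_vec_def unit_vec_def)
      qed (use \<open>i < j\<close> in \<open>auto simp: sym_vec_def unit_vec_def\<close>)
    qed
    then have "(\<Sum>(i, j, k)\<in>Q. l i j k * sym_vec i j k p q r)
        = (\<Sum>s\<in>Q. if s = (min p q, max p q, r) then l p q r else 0)"
      by (intro sum.cong) (auto split: if_splits)
    also have "\<dots> = (if (min p q, max p q, r) \<in> Q then l p q r else 0)"
      using fin by simp
    also have "(min p q, max p q, r) \<in> Q \<longleftrightarrow> p \<noteq> q \<and> r \<noteq> p \<and> r \<noteq> q"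
      using pqr by (auto simp: Q_def min_def max_def)
    finally show ?thesis .
  qed
  have 3: "(\<Sum>(i, j)\<in>P. l i j j * unit_vec i j j p q r) = (if p \<noteq> q \<and> q = r then l p q r else 0)"
  proof -
    have "(\<Sum>(i, j)\<in>P. l i j j * unit_vec i j j p q r)
        = (\<Sum>s\<in>P. if s = (p, q) then (if q = r then l p q r else 0) else 0)"
      by (intro sum.cong) (auto simp: unit_vec_def split: if_splits)
    then show ?thesis using fin pqr by (auto simp: P_def)
  qed
  have 4: "(\<Sum>(i, j)\<in>P. l i j j * unit_vec j i j p q r) = (if p \<noteq> q \<and> p = r then l p q r else 0)"
  proof -
    have "(\<Sum>(i, j)\<in>P. l i j j * unit_vec j i j p q r)
        = (\<Sum>s\<in>P. if s = (q, p) then (if p = r then l p q r else 0) else 0)"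
      by (intro sum.cong) (auto simp: unit_vec_def N_mod_sym[OF l, of q p] split: if_splits)
    then show ?thesis using fin pqr by (auto simp: P_def)
  qed
  have 5: "(\<Sum>(i, j)\<in>P. l i j j * unit_vec i i i p q r) = (if p = q \<and> p = r then - l p q r else 0)"
  proof -
    \<comment> \<open>Grouping by \<open>i\<close> turns the inner sum over \<open>j\<close> into
      the trace condition for row \<open>i\<close>.\<close>
    have "P = Sigma {1..n} (\<lambda>i. {1..n} - {i})" by (auto simp: P_def)
    then have "(\<Sum>(i, j)\<in>P. l i j j * unit_vec i i i p q r)
        = (\<Sum>i\<in>{1..n}. \<Sum>j\<in>{1..n} - {i}. l i j j * unit_vec i i i p q r)"
      by (simp add: sum.Sigma)
    also have "\<dots> = (\<Sum>i\<in>{1..n}. - l i i i * unit_vec i i i p q r)"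
      using N_mod_trace[OF l] by (intro sum.cong) (simp_all add: sum_distrib_right)
    also have "\<dots> = (\<Sum>i\<in>{1..n}. if i = p then (if p = q \<and> p = r then - l p q r else 0) else 0)"
      by (intro sum.cong) (auto simp: unit_vec_def split: if_splits)
    also have "\<dots> = (if p = q \<and> p = r then - l p q r else 0)" using pqr by simp
    finally show ?thesis .
  qed
  have "(\<Sum>(i, j)\<in>P. l i j j * tr_vec i j p q r)
      = (\<Sum>(i, j)\<in>P. l i j j * unit_vec i j j p q r) + (\<Sum>(i, j)\<in>P. l i j j * unit_vec j i j p q r)
        - (\<Sum>(i, j)\<in>P. l i j j * unit_vec i i i p q r)"
    by (simp add: tr_vec_def sym_vec_def case_prod_unfold algebra_simps sum.distrib sum_subtractf)
  \<comment> \<open>The five patterns exclude each other and cover all index triples; the minus sign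
    in the fifth cancels against the one in \<open>tr_vec\<close>.\<close>
  then show ?thesis unfolding 1 2 3 4 5 by auto
qed

section \<open>Submodules that contain \<open>N_mod\<close>\<close>

context
  fixes W assumes W: "gsubmodule GL base_field (Lambda n) act W"
begin

lemma gsub_Lambda: "W \<subseteq> carrier (Lambda n)"
  using Lam.gsubmoduleD(1)[OF W] .

lemma gsub_act: "\<lbrakk>l \<in> W; g \<in> carrier GL\<rbrakk> \<Longrightarrow> act l g \<in> W"
  using Lam.gsubmoduleD(5)[OF W] .

lemma gsub_zero: "(\<lambda>i j k. 0) \<in> W"
  using Lam.gsubmoduleD(2)[OF W] by simp

lemma gsub_add: "\<lbrakk>l \<in> W; l' \<in> W\<rbrakk> \<Longrightarrow> (\<lambda>i j k. l i j k + l' i j k) \<in> W"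
  using Lam.gsubmoduleD(3)[OF W] by simp

lemma gsub_smult: "l \<in> W \<Longrightarrow> (\<lambda>i j k. a * l i j k) \<in> W"
  using Lam.gsubmoduleD(4)[OF W] by simp

lemma gsub_diff: "\<lbrakk>l \<in> W; l' \<in> W\<rbrakk> \<Longrightarrow> (\<lambda>i j k. l i j k - l' i j k) \<in> W"
  using gsub_add[of l "\<lambda>i j k. -1 * l' i j k"] gsub_smult[of l' "-1"] by simp

lemma gsub_sum: "(\<And>s. s \<in> S \<Longrightarrow> f s \<in> W) \<Longrightarrow> (\<lambda>i j k. \<Sum>s\<in>S. c s * f s i j k) \<in> W"
  by (induction S rule: infinite_finite_induct) (auto simp: gsub_zero intro!: gsub_add gsub_smult)

lemma N_subset_of_generators:
  assumes unit: "\<And>i k. \<lbrakk>i \<in> {1..n}; k \<in> {1..n}; i \<noteq> k\<rbrakk> \<Longrightarrow> unit_vec i i k \<in> W"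
    and sym: "\<And>i j k. \<lbrakk>i \<in> {1..n}; j \<in> {1..n}; k \<in> {1..n}; i \<noteq> j; k \<noteq> i; k \<noteq> j\<rbrakk> \<Longrightarrow> sym_vec i j k \<in> W"
    and tr: "\<And>i j. \<lbrakk>i \<in> {1..n}; j \<in> {1..n}; i \<noteq> j\<rbrakk> \<Longrightarrow> tr_vec i j \<in> W"
  shows "N_mod \<subseteq> W"
proof
  fix l assume l: "l \<in> N_mod"
  define P where "P = {(i, k). i \<in> {1..n} \<and> k \<in> {1..n} \<and> i \<noteq> k}"
  define Q where "Q = {(i, j, k). i \<in> {1..n} \<and> j \<in> {1..n} \<and> k \<in> {1..n} \<and> i < j \<and> k \<noteq> i \<and> k \<noteq> j}"
  define l' where "l' = (\<lambda>p q r. (\<Sum>s\<in>P. (case s of (i, k) \<Rightarrow> l i i k) * (case s of (i, k) \<Rightarrow> unit_vec i i k) p q r)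
    + (\<Sum>s\<in>Q. (case s of (i, j, k) \<Rightarrow> l i j k) * (case s of (i, j, k) \<Rightarrow> sym_vec i j k) p q r)
    + (\<Sum>s\<in>P. (case s of (i, j) \<Rightarrow> l i j j) * (case s of (i, j) \<Rightarrow> tr_vec i j) p q r))"
  have l': "l' \<in> W"
    unfolding l'_def by (intro gsub_add gsub_sum) (auto simp: P_def Q_def intro: unit sym tr)
  have "l = l'"
  proof (rule Lambda_eqI)
    show "l \<in> carrier (Lambda n)" using l by (simp add: N_mod_def C_mod_def)
    show "l' \<in> carrier (Lambda n)" using l' gsub_Lambda by blast
    show "l p q r = l' p q r" if "p \<in> {1..n}" "q \<in> {1..n}" "r \<in> {1..n}" for p q r
      unfolding N_mod_decomposition[OF l that] l'_def P_def Q_def by (simp add: case_prod_unfold)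
  qed
  then show "l \<in> W" using l' by simp
qed

text \<open>Permuting the basis acts on elementary structure vectors. The permutation runs from the
  primed to the unprimed indices because functionals are pulled back and \<open>v k\<close> is moved
  by the inverse.\<close>

lemma unit_vec_transitive:
  assumes "unit_vec i i k \<in> W" "i \<in> {1..n}" "k \<in> {1..n}" "i \<noteq> k"
    and "i' \<in> {1..n}" "k' \<in> {1..n}" "i' \<noteq> k'"
  shows "unit_vec i' i' k' \<in> W"
proof -
  obtain g h where g: "g \<in> carrier GL" and h: "bij_betw h {1..n} {1..n}" "h i' = i" "h k' = k"
    and gv: "\<And>j. j \<in> {1..n} \<Longrightarrow> g (v j) = v (h j)"
    by (rule GL_exists_permutation[OF assms(5-7) assms(2-4)]) blast
  have h_in: "h j \<in> {1..n}" if "j \<in> {1..n}" for j using h(1) that by (auto simp: bij_betw_def)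
  have coord_h: "coord (v (h j)) i = (if j = i' then 1 else 0)" if "j \<in> {1..n}" for j
    using coord_basis[OF h_in[OF that] assms(2)] inj_on_eq_iff[OF bij_betw_imp_inj_on[OF h(1)] that assms(5)] h(2) by simp
  have inv: "inv_into UNIV g (v k) = v k'"
    using gv[OF assms(6)] GL_D(5)[OF g, of "v k'"] h(3) by simp
  have "act (unit_vec i i k) g = unit_vec i' i' k'"
    by (rule Lambda_eqI[OF act_in_Lambda unit_vec_in_Lambda])
       (use assms in \<open>auto simp: act_unit_vec[OF assms(2,2,3) _ _ _ g] inv gv coord_h unit_vec_def\<close>)
  then show ?thesis using gsub_act[OF assms(1) g] by simp
qed

text \<open>A transvection sends \<open>unit_vec i i k\<close> to \<open>(x\<^sub>i + a x\<^sub>j)\<^sup>2 \<otimes> (v\<^sub>k - a \<delta>\<^sub>j\<^sub>k v\<^sub>i)\<close>. For \<open>k = j\<close> this yields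
  \<open>a A\<^sub>i\<^sub>j - a\<^sup>2 A\<^sub>j\<^sub>i\<close> with \<open>A\<^sub>i\<^sub>j = tr_vec i j\<close>, and two values of \<open>a\<close> outside \<open>{0}\<close> separate the two terms.\<close>

lemma N_subset_of_unit_vec:
  assumes card: "infinite (UNIV :: 'f set) \<or> card (UNIV :: 'f set) > 2"
    and unit: "\<And>i k. \<lbrakk>i \<in> {1..n}; k \<in> {1..n}; i \<noteq> k\<rbrakk> \<Longrightarrow> unit_vec i i k \<in> W"
  shows "N_mod \<subseteq> W"
proof -
  \<comment> \<open>This map sends \<open>v j\<close> to \<open>v j + a *s v i\<close> and fixes the
    other basis vectors.\<close>
  define g where "g i j a = transvection (\<lambda>x. a * coord x j) (v i)" for i j a
  have g: "g i j a \<in> carrier GL" "inv_into UNIV (g i j a) x = x - (a * coord x j) *s v i"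
    if "i \<in> {1..n}" "j \<in> {1..n}" "i \<noteq> j" for i j a x
    unfolding g_def using that
    by (intro transvection_in_GL inv_transvection; simp add: algebra_simps)+
  have act: "act (unit_vec i i k) (g i j a) p q r
      = (coord (v p) i + a * coord (v p) j) * (coord (v q) i + a * coord (v q) j)
        * (coord (v k) r - a * coord (v k) j * coord (v i) r)"
    if "i \<in> {1..n}" "j \<in> {1..n}" "i \<noteq> j" "k \<in> {1..n}" "p \<in> {1..n}" "q \<in> {1..n}" "r \<in> {1..n}"
    for i j k a p q r
    using that
    by (simp add: act_unit_vec g del: coord_basis)
       (simp add: g_def transvection_def coord_basis[OF that(1,1)] del: coord_basis)
  show ?thesis
  proof (rule N_subset_of_generators[OF unit])
    fix i j k assume ijk: "i \<in> {1..n}" "j \<in> {1..n}" "k \<in> {1..n}" "i \<noteq> j" "k \<noteq> i" "k \<noteq> j"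
    \<comment> \<open>Polarisation of the square of \<open>x\<^sub>i + x\<^sub>j\<close>; the vector
      \<open>v k\<close> is fixed because \<open>k \<noteq> j\<close>.\<close>
    let ?w = "\<lambda>p q r. act (unit_vec i i k) (g i j 1) p q r - unit_vec i i k p q r - unit_vec j j k p q r"
    have w: "?w \<in> W" using ijk by (intro gsub_diff gsub_act g unit) auto
    have "?w = sym_vec i j k"
      by (rule Lambda_eqI[OF subsetD[OF gsub_Lambda w]])
         (use ijk in \<open>auto simp: act sym_vec_def unit_vec_def Lambda_def\<close>)
    then show "sym_vec i j k \<in> W" using w by simp
  next
    fix i j assume ij: "i \<in> {1..n}" "j \<in> {1..n}" "i \<noteq> j"
    \<comment> \<open>The subtracted and added multiples remove the terms of degree 0 and 3 in
      \<open>a\<close>.\<close>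
    let ?w = "\<lambda>a p q r. act (unit_vec j j i) (g j i a) p q r - unit_vec j j i p q r
      + (a * (a * a)) * unit_vec i i j p q r"
    have w: "?w a \<in> W" for a using ij by (intro gsub_add gsub_diff gsub_act gsub_smult g unit) auto
    have w_eq: "?w a p q r = a * tr_vec j i p q r - (a * a) * tr_vec i j p q r"
      if "p \<in> {1..n}" "q \<in> {1..n}" "r \<in> {1..n}" for a p q r
      using ij that by (auto simp: act tr_vec_def sym_vec_def unit_vec_def)
    obtain t :: 'f where t: "t \<noteq> 0" "t \<noteq> 1" using field_elem_not_0_1[OF card] .
    \<comment> \<open>Subtracting \<open>t\<close> times the value at 1 cancels the linear term and
      leaves \<open>t - t * t\<close> times \<open>tr_vec i j\<close>.\<close>
    let ?u = "\<lambda>p q r. (1 / (t - t * t)) * (?w t p q r - t * ?w 1 p q r)"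
    have u: "?u \<in> W" by (intro gsub_smult gsub_diff w)
    have "?u = tr_vec i j"
    proof (rule Lambda_eqI[OF subsetD[OF gsub_Lambda u]])
      show "tr_vec i j \<in> carrier (Lambda n)"
        using ij by (auto simp: tr_vec_def sym_vec_def unit_vec_def Lambda_def split: if_splits)
      fix p q r assume pqr: "p \<in> {1..n}" "q \<in> {1..n}" "r \<in> {1..n}"
      have "t - t * t \<noteq> 0" using t by auto
      moreover have "?w t p q r - t * ?w 1 p q r = (t - t * t) * tr_vec i j p q r"
        unfolding w_eq[OF pqr] by (simp add: algebra_simps)
      ultimately show "?u p q r = tr_vec i j p q r" by simp
    qed
    then show "tr_vec i j \<in> W" using u by simp
  qed
qed

text \<open>With \<open>\<phi> = a x\<^sub>3 + b x\<^sub>2\<close> and \<open>w = v\<^sub>1\<close>, the \<open>a\<^sup>2 b\<close>-coefficient of the product transformed by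
  \<open>1 + \<phi> \<otimes> w\<close> comes from its cubic term \<open>- \<phi>(x) \<phi>(y) \<phi>([w, w]) w\<close> alone. The weights below are a second
  difference in \<open>a\<close> (at \<open>0, 1, t\<close>) and a first difference in \<open>b\<close>, which isolate this coefficient even
  over the field with three elements, where \<open>a\<^sup>3 = a\<close>.\<close>

lemma unit_vec_331_in_gsub:
  assumes card: "infinite (UNIV :: 'f set) \<or> card (UNIV :: 'f set) > 2" and n: "n \<ge> 3"
    and l: "l \<in> W" "l \<notin> Mss_mod"
  shows "unit_vec 3 3 1 \<in> W"
proof -
  have idx: "1 \<in> {1..n}" "2 \<in> {1..n}" "3 \<in> {1..n}" using n by auto
  obtain x where x: "\<And>a. bracket l x x \<noteq> a *s x"
    using l gsub_Lambda by (auto simp: Mss_mod_def)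
  define z where "z = bracket l x x"
  \<comment> \<open>The scalars 0 and 1 exclude \<open>z = 0\<close> and
    \<open>z = x\<close>.\<close>
  have xz: "x \<noteq> 0" "z \<noteq> 0" "x \<noteq> z" "z \<notin> span {x}"
    using x[of 0] x[of 1] x by (auto simp: z_def span_singleton)
  then have "independent {x, z}"
    by (subst insert_commute) (simp add: independent_insert)
  then obtain g0 where g0: "g0 \<in> carrier GL" "g0 (v 1) = x" "g0 (v 2) = z"
    using GL_exists_extend_pair[of x z] xz n by auto
  define m where "m = act l g0"
  have m: "m \<in> W" using gsub_act[OF l(1) g0(1)] by (simp add: m_def)
  have m_sq: "bracket m (v 1) (v 1) = v 2"
    using GL_D(5)[OF g0(1), of "v 2"] by (simp add: m_def bracket_act g0 z_def)
  \<comment> \<open>Both coordinates vanish on \<open>v 1\<close>, and the functional takes the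
    value \<open>b\<close> on \<open>v 2\<close>, the square of \<open>v 1\<close>. Having a third
    coordinate is where \<open>n \<ge> 3\<close> enters.\<close>
  define \<phi> where "\<phi> a b x = a * coord x 3 + b * coord x 2" for a b x
  define g where "g a b = transvection (\<phi> a b) (v 1)" for a b
  have g: "g a b \<in> carrier GL" "inv_into UNIV (g a b) x = x - \<phi> a b x *s v 1" for a b x
    unfolding g_def using idx
    by (intro transvection_in_GL inv_transvection; simp add: \<phi>_def algebra_simps)+
  define M where "M a b = act m (g a b)" for a b
  have M: "M a b \<in> W" for a b using gsub_act[OF m g(1)] by (simp add: M_def)
  have brM: "bracket (M a b) x y = (let u = bracket m x y + \<phi> a b x *s bracket m (v 1) y
      + \<phi> a b y *s bracket m x (v 1) + (\<phi> a b x * \<phi> a b y) *s v 2 in u - \<phi> a b u *s v 1)" for a b x y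
    unfolding M_def bracket_act[OF g(1)] g(2) Let_def
    by (simp add: g_def transvection_def bracket_add_left bracket_add_right bracket_scale_left
        bracket_scale_right m_sq algebra_simps)
  obtain t :: 'f where t: "t \<noteq> 0" "t \<noteq> 1" using field_elem_not_0_1[OF card] .
  \<comment> \<open>The weights 1, \<open>-t\<close>, \<open>t - 1\<close> at
    \<open>a = t, 1, 0\<close> annihilate constants and \<open>a\<close>, and send
    \<open>a * a\<close> to \<open>t * t - t\<close>; this sign cancels the one of the cubic term.
    Subtracting the values at \<open>b = 0\<close> removes what does not involve
    \<open>b\<close>.\<close>
  let ?u = "\<lambda>p q r. (1 / (t - t * t)) * ((M t 1 p q r - t * M 1 1 p q r + (t - 1) * M 0 1 p q r)
    - (M t 0 p q r - t * M 1 0 p q r + (t - 1) * M 0 0 p q r))"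
  have u: "?u \<in> W" by (intro gsub_smult gsub_diff gsub_add M)
  have "?u = unit_vec 3 3 1"
  proof (rule Lambda_eqI[OF subsetD[OF gsub_Lambda u] unit_vec_in_Lambda])
    fix p q r assume pqr: "p \<in> {1..n}" "q \<in> {1..n}" "r \<in> {1..n}"
    define bpq b1q bp1 where "bpq = bracket m (v p) (v q)" and "b1q = bracket m (v 1) (v q)"
      and "bp1 = bracket m (v p) (v 1)"
    have M_eq: "M a b p q r = (let u = bpq + \<phi> a b (v p) *s b1q
      + \<phi> a b (v q) *s bp1 + (\<phi> a b (v p) * \<phi> a b (v q)) *s v 2 in coord (u - \<phi> a b u *s v 1) r)" for a b
      using coord_bracket_basis[OF pqr, of "M a b"] by (simp add: brM bpq_def b1q_def bp1_def Let_def)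
    have nz: "t - t * t \<noteq> 0" using t by auto
    have v1_v2: "coord (v 1) 2 = 0" "coord (v 1) 3 = 0" "coord (v 2) 2 = 1" "coord (v 2) 3 = 0"
      using idx by simp_all
    have "(M t 1 p q r - t * M 1 1 p q r + (t - 1) * M 0 1 p q r)
        - (M t 0 p q r - t * M 1 0 p q r + (t - 1) * M 0 0 p q r)
        = (t - t * t) * (coord (v p) 3 * coord (v q) 3 * coord (v 1) r)"
      unfolding M_eq Let_def \<phi>_def using v1_v2
      by (simp add: algebra_simps del: coord_basis)
    also have "coord (v p) 3 * coord (v q) 3 * coord (v 1) r = unit_vec 3 3 1 p q r"
      using idx pqr by (auto simp: unit_vec_def)
    finally show "?u p q r = unit_vec 3 3 1 p q r" using nz by simp
  qed (use idx in auto)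
  then show ?thesis using u by simp
qed

text \<open>One elementary vector yields all by permutation, and these generate
  \<open>N_mod\<close>. Applied to cyclic submodules it gives the degeneration, applied to
  submodules of \<open>N_mod\<close> the irreducibility.\<close>

lemma N_subset_of_not_Mss:
  assumes "infinite (UNIV :: 'f set) \<or> card (UNIV :: 'f set) > 2" "n \<ge> 3" "l \<in> W" "l \<notin> Mss_mod"
  shows "N_mod \<subseteq> W"
  using assms unit_vec_transitive[OF unit_vec_331_in_gsub[OF assms]]
  by (intro N_subset_of_unit_vec) auto

end

section \<open>Irreducibility of the quotient and the final theorem\<close>

lemma irreducible_N_quot:
  assumes "infinite (UNIV :: 'f set) \<or> card (UNIV :: 'f set) > 2" "n \<ge> 3"
  shows "irreducible_gmodule GL base_field N_quot N_quot_act"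
proof -
  interpret N: right_gmodule GL base_field "(Lambda n)\<lparr>carrier := N_mod\<rparr>" act
    by (rule Lam.right_gmodule_gsubmodule[OF gsubmodule_N])
  \<comment> \<open>The vector \<open>delta\<close> witnesses that the quotient is nonzero.\<close>
  have "unit_vec 1 1 2 \<in> N_mod" "unit_vec 1 1 2 \<notin> Mss_mod"
    using assms(2) unit_vec_in_N[of 1 2] unit_vec_not_in_Mss[of 1 2] by auto
  then have ne: "N_mod \<inter> Mss_mod \<noteq> carrier ((Lambda n)\<lparr>carrier := N_mod\<rparr>)" by auto
  have H: "gsubmodule GL base_field ((Lambda n)\<lparr>carrier := N_mod\<rparr>) act (N_mod \<inter> Mss_mod)"
    by (intro Lam.gsubmodule_restrict Lam.gsubmodule_Int gsubmodule_N gsubmodule_Mss) auto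
  show ?thesis
    unfolding N_quot_def N_quot_act_def
  proof (rule N.irreducible_gmodule_quot[OF H ne])
    fix U x assume U: "gsubmodule GL base_field ((Lambda n)\<lparr>carrier := N_mod\<rparr>) act U"
      and x: "x \<in> U" "x \<notin> N_mod \<inter> Mss_mod"
    have "U \<subseteq> N_mod" using N.gsubmoduleD(1)[OF U] by simp
    moreover have "N_mod \<subseteq> U"
      using N_subset_of_not_Mss[OF Lam.gsubmodule_trans[OF gsubmodule_N U] assms x(1)] x calculation by auto
    ultimately show "U = carrier ((Lambda n)\<lparr>carrier := N_mod\<rparr>)" by simp
  qed
qed

end

theorem proposition9p2:
  fixes scale :: "'f::field \<Rightarrow> 'v::ab_group_add \<Rightarrow> 'v"
    and n :: nat and v :: "nat \<Rightarrow> 'v"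
  assumes "based_vector_space scale n v"
    and "infinite (UNIV :: 'f set) \<or> card (UNIV :: 'f set) > 2"
    and "n \<ge> 3"
  shows "(\<forall>l. l \<in> based_vector_space.C_mod scale n v \<and> l \<notin> based_vector_space.Mss_mod scale n v \<longrightarrow>
           based_vector_space.linearly_degenerates scale n v l delta \<and>
           based_vector_space.N_mod scale n v \<subseteq> based_vector_space.FG_submodule scale n v l)
       \<and> irreducible_gmodule (based_vector_space.GL scale) base_field
           (based_vector_space.N_quot scale n v) (based_vector_space.N_quot_act scale n v)"
proof -
  interpret based_vector_space scale n v by fact
  \<comment> \<open>Degeneration to \<open>delta\<close> thus follows from the inclusion of
    \<open>N_mod\<close>.\<close>
  have "delta \<in> N_mod"
    using assms(3) unit_vec_in_N[of 1 2] by (simp add: delta_eq_unit_vec)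
  moreover have "N_mod \<subseteq> FG_submodule l" if "l \<in> C_mod" "l \<notin> Mss_mod" for l
  proof -
    have "l \<in> carrier (Lambda n)" using that(1) by (simp add: C_mod_def)
    then show ?thesis
      unfolding FG_submodule_def using that(2)
      by (intro N_subset_of_not_Mss[OF Lam.gsubmodule_cyclic assms(2,3) Lam.cyclic_self])
  qed
  ultimately show ?thesis
    using irreducible_N_quot[OF assms(2,3)] by (auto simp: linearly_degenerates_def)
qed

end
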